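(* Let $G$ be a branch group acting on an infinite set $X$, and let $W$ be a non-trivial group. Then the permutational wreath product $W\wr_X G$ is not finitely presented.
   Context: The permutational wreath product is $W\wr_X G=\left(\bigoplus_{x\in X}W\right)\rtimes G$, where $G$ acts on the direct sum (finitely supported functions $X\to W$) by permuting the coordinates according to its action on $X$. The action of $G$ on $X$ is an arbitrary action on a set. Here $\mathbb{N}=\{0,1,2,\dots\}$. Let $(A_i)_{i\in\mathbb{N}}$ be a sequence of finite sets with $|A_i|\ge 2$. The associated (spherically homogeneous) rooted tree $T$ has as vertices all finite words $v=(a_0,\dots,a_{k-1})\in A_0\times\cdots\times A_{k-1}$, $k\ge 0$, with root the empty word; $|v|=k$ is the length of $v$; $v\le w$ means that $v$ is a prefix of $w$; $v$ and $w$ are adjacent if $v\le w$ and $|w|=|v|+1$ (or vice versa). The $n$th level $\mathcal{L}_n$ is the set of vertices of length $n$, and $T_v$ is the subtree of all $w\ge v$. $\operatorname{Aut}(T)$ is the group of graph automorphisms of $T$ fixing the root. For $G\le\operatorname{Aut}(T)$ and $v\in T$, $\operatorname{Rist}_G(v)=\{g\in G: gw=w \text{ for all } w\notin T_v\}$, and $\operatorname{Rist}_G(n)$ is the subgroup generated by all $\operatorname{Rist}_G(v)$, $v\in\mathcal{L}_n$. $G\le\operatorname{Aut}(T)$ is a branch group if $G$ acts transitively on $\mathcal{L}_n$ for every $n\in\mathbb{N}$ and $\operatorname{Rist}_G(n)$ has finite index in $G$ for every $n\in\mathbb{N}$. *)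

theory Defs
  imports "HOL-Algebra.Group_Action" "HOL-Algebra.Product_Groups" "HOL-Library.Sublist"
begin

section \<open>Spherically homogeneous rooted trees and branch groups\<close>

text \<open>All levels take their alphabets \<open>A i\<close> from one type \<open>'a\<close>. Since the alphabets
  are finite and there are countably many of them, this is no restriction.\<close>

definition tree_verts :: "(nat \<Rightarrow> 'a set) \<Rightarrow> 'a list set" where
  "tree_verts A = {v. \<forall>i<length v. v ! i \<in> A i}"

definition tree_level :: "(nat \<Rightarrow> 'a set) \<Rightarrow> nat \<Rightarrow> 'a list set" where
  "tree_level A n = {v \<in> tree_verts A. length v = n}"

definition tree_adj :: "'a list \<Rightarrow> 'a list \<Rightarrow> bool" where
  "tree_adj v w \<longleftrightarrow>
     prefix v w \<and> length w = length v + 1 \<or> prefix w v \<and> length v = length w + 1"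

definition subtree :: "(nat \<Rightarrow> 'a set) \<Rightarrow> 'a list \<Rightarrow> 'a list set" where
  "subtree A v = {w \<in> tree_verts A. prefix v w}"

definition tree_aut :: "(nat \<Rightarrow> 'a set) \<Rightarrow> ('a list \<Rightarrow> 'a list) monoid" where
  "tree_aut A = BijGroup (tree_verts A)
     \<lparr>carrier := {g \<in> Bij (tree_verts A). g [] = [] \<and>
        (\<forall>v\<in>tree_verts A. \<forall>w\<in>tree_verts A. tree_adj (g v) (g w) \<longleftrightarrow> tree_adj v w)}\<rparr>"

text \<open>A subgroup of \<open>Aut(T)\<close> is given by its set \<open>G\<close> of elements; the group itself is
  \<open>(tree_aut A)\<lparr>carrier := G\<rparr>\<close>.\<close>

definition rist ::
    "(nat \<Rightarrow> 'a set) \<Rightarrow> ('a list \<Rightarrow> 'a list) set \<Rightarrow> 'a list \<Rightarrow> ('a list \<Rightarrow> 'a list) set" where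
  "rist A G v = {g \<in> G. \<forall>w \<in> tree_verts A - subtree A v. g w = w}"

definition rist_level ::
    "(nat \<Rightarrow> 'a set) \<Rightarrow> ('a list \<Rightarrow> 'a list) set \<Rightarrow> nat \<Rightarrow> ('a list \<Rightarrow> 'a list) set" where
  "rist_level A G n = generate (tree_aut A) (\<Union>v\<in>tree_level A n. rist A G v)"

definition branch_group :: "(nat \<Rightarrow> 'a set) \<Rightarrow> ('a list \<Rightarrow> 'a list) set \<Rightarrow> bool" where
  "branch_group A G \<longleftrightarrow>
     subgroup G (tree_aut A) \<and>
     (\<forall>n. \<forall>v\<in>tree_level A n. \<forall>w\<in>tree_level A n. \<exists>g\<in>G. g v = w) \<and>
     (\<forall>n. finite (rcosets\<^bsub>(tree_aut A)\<lparr>carrier := G\<rparr>\<^esub> (rist_level A G n)))"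

lemma group_tree_aut: "group (tree_aut A)"
proof -
  let ?V = "tree_verts A"
  let ?H = "carrier (tree_aut A)"
  interpret B: group "BijGroup ?V" by (rule group_BijGroup)
  have nil: "[] \<in> ?V" by (simp add: tree_verts_def)
  have "subgroup ?H (BijGroup ?V)"
  proof (rule B.subgroupI)
    show "?H \<subseteq> carrier (BijGroup ?V)" by (auto simp: tree_aut_def BijGroup_def)
    have "(\<lambda>v\<in>?V. v) \<in> ?H" using nil by (auto simp: tree_aut_def id_Bij)
    then show "?H \<noteq> {}" by blast
  next
    fix g assume g: "g \<in> ?H"
    then have gB: "g \<in> Bij ?V" by (simp add: tree_aut_def)
    then have bij: "bij_betw g ?V ?V" by (simp add: Bij_def)
    let ?h = "inv_into ?V g"
    have mem: "?h v \<in> ?V" and gh: "g (?h v) = v" if "v \<in> ?V" for v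
      using that gB bij by (auto simp: Bij_inv_into_mem bij_betw_inv_into_right)
    have "g [] = []" using g by (simp add: tree_aut_def)
    then have "?h [] = []" using bij_betw_inv_into_left[OF bij nil] by simp
    moreover have "tree_adj (?h v) (?h w) \<longleftrightarrow> tree_adj v w" if "v \<in> ?V" "w \<in> ?V" for v w
    proof -
      have "tree_adj (g (?h v)) (g (?h w)) \<longleftrightarrow> tree_adj (?h v) (?h w)"
        using g mem[OF that(1)] mem[OF that(2)] by (simp add: tree_aut_def)
      then show ?thesis by (simp add: gh that)
    qed
    ultimately show "inv\<^bsub>BijGroup ?V\<^esub> g \<in> ?H"
      using gB nil by (simp add: inv_BijGroup tree_aut_def restrict_inv_into_Bij)
  next
    fix g h assume "g \<in> ?H" "h \<in> ?H"
    then show "g \<otimes>\<^bsub>BijGroup ?V\<^esub> h \<in> ?H"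
      using nil by (auto simp: tree_aut_def BijGroup_def compose_Bij compose_eq Pi_iff
          dest!: Bij_imp_funcset)
  qed
  then have "group (BijGroup ?V \<lparr>carrier := ?H\<rparr>)" by (rule B.subgroup_imp_group)
  then show ?thesis by (simp add: tree_aut_def)
qed

section \<open>Permutational wreath products\<close>

definition semidirect_product ::
    "('n, 'c) monoid_scheme \<Rightarrow> ('h, 'd) monoid_scheme \<Rightarrow> ('h \<Rightarrow> 'n \<Rightarrow> 'n) \<Rightarrow> ('n \<times> 'h) monoid" where
  "semidirect_product N H \<theta> =
     \<lparr>carrier = carrier N \<times> carrier H,
      monoid.mult = (\<lambda>(n, h) (n', h'). (n \<otimes>\<^bsub>N\<^esub> \<theta> h n', h \<otimes>\<^bsub>H\<^esub> h')),
      one = (\<one>\<^bsub>N\<^esub>, \<one>\<^bsub>H\<^esub>)\<rparr>"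

text \<open>\<open>W \<wr>\<^sub>X G\<close> for the action \<open>\<phi>\<close> of \<open>G\<close> on \<open>X\<close>; the element \<open>g\<close> moves the
  coordinate at \<open>x\<close> to \<open>g x\<close>, i.e. \<open>(g f)(x) = f (g\<inverse> x)\<close>.\<close>

definition wreath_product ::
    "('w, 'c) monoid_scheme \<Rightarrow> 'x set \<Rightarrow> ('g \<Rightarrow> 'x \<Rightarrow> 'x) \<Rightarrow> ('g, 'd) monoid_scheme
      \<Rightarrow> (('x \<Rightarrow> 'w) \<times> 'g) monoid" where
  "wreath_product W X \<phi> G =
     semidirect_product (sum_group X (\<lambda>_. W)) G (\<lambda>g f. \<lambda>x\<in>X. f (\<phi> (inv\<^bsub>G\<^esub> g) x))"

lemma group_semidirect_product:
  assumes "group N" "group H"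
    and closed: "\<And>h n. \<lbrakk>h \<in> carrier H; n \<in> carrier N\<rbrakk> \<Longrightarrow> \<theta> h n \<in> carrier N"
    and hom: "\<And>h. h \<in> carrier H \<Longrightarrow> \<theta> h \<in> hom N N"
    and comp: "\<And>h k n. \<lbrakk>h \<in> carrier H; k \<in> carrier H\<rbrakk> \<Longrightarrow> \<theta> h (\<theta> k n) = \<theta> (h \<otimes>\<^bsub>H\<^esub> k) n"
    and one: "\<And>n. n \<in> carrier N \<Longrightarrow> \<theta> \<one>\<^bsub>H\<^esub> n = n"
  shows "group (semidirect_product N H \<theta>)"
proof -
  interpret N: group N by fact
  interpret H: group H by fact
  have mult: "\<theta> h (m \<otimes>\<^bsub>N\<^esub> n) = \<theta> h m \<otimes>\<^bsub>N\<^esub> \<theta> h n"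
    if "h \<in> carrier H" "m \<in> carrier N" "n \<in> carrier N" for h m n
    using hom_mult[OF hom[OF that(1)] that(2,3)] .
  show ?thesis
  proof (rule groupI)
    fix p assume "p \<in> carrier (semidirect_product N H \<theta>)"
    then obtain n h where p: "p = (n, h)" "n \<in> carrier N" "h \<in> carrier H"
      by (auto simp: semidirect_product_def)
    let ?q = "(\<theta> (inv\<^bsub>H\<^esub> h) (inv\<^bsub>N\<^esub> n), inv\<^bsub>H\<^esub> h)"
    have "\<theta> (inv\<^bsub>H\<^esub> h) (inv\<^bsub>N\<^esub> n) \<otimes>\<^bsub>N\<^esub> \<theta> (inv\<^bsub>H\<^esub> h) n = \<theta> (inv\<^bsub>H\<^esub> h) \<one>\<^bsub>N\<^esub>"
      using p by (simp flip: mult)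
    also have "\<dots> = \<one>\<^bsub>N\<^esub>"
      using hom[of "inv\<^bsub>H\<^esub> h"] p(3) N.is_group by (simp add: hom_one)
    finally show "\<exists>q\<in>carrier (semidirect_product N H \<theta>).
        q \<otimes>\<^bsub>semidirect_product N H \<theta>\<^esub> p = \<one>\<^bsub>semidirect_product N H \<theta>\<^esub>"
      using p closed by (intro bexI[of _ ?q]) (auto simp: semidirect_product_def)
  qed (auto simp: semidirect_product_def closed mult comp one N.m_assoc H.m_assoc)
qed

lemma group_wreath_product:
  assumes "group W" "group_action G X \<phi>"
  shows "group (wreath_product W X \<phi> G)"
proof -
  interpret W: group W by fact
  interpret act: group_action G X \<phi> by fact
  interpret G: group G using act.group_hom by (simp add: group_hom_def)
  let ?N = "sum_group X (\<lambda>_. W)"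
  let ?p = "\<lambda>g f. \<lambda>x\<in>X. f (\<phi> (inv\<^bsub>G\<^esub> g) x)"
  have N: "group ?N" using W.is_group by simp
  interpret N: group ?N by (rule N)
  have carr: "f \<in> carrier ?N \<longleftrightarrow> f \<in> X \<rightarrow>\<^sub>E carrier W \<and> finite {x \<in> X. f x \<noteq> \<one>\<^bsub>W\<^esub>}" for f
    using W.is_group by (simp add: carrier_sum_group)
  have X: "\<phi> g x \<in> X" if "g \<in> carrier G" "x \<in> X" for g x
    using act.element_image[OF that refl] .
  have comp: "\<phi> (g \<otimes>\<^bsub>G\<^esub> h) x = \<phi> g (\<phi> h x)" if "g \<in> carrier G" "h \<in> carrier G" "x \<in> X" for g h x
    using act.composition_rule[OF that(3,1,2)] .
  have inv1: "\<phi> g (\<phi> (inv\<^bsub>G\<^esub> g) x) = x" if "g \<in> carrier G" "x \<in> X" for g x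
    using that comp[of g "inv\<^bsub>G\<^esub> g" x] act.id_eq_one by (metis G.inv_closed G.r_inv restrict_apply')
  have closed: "?p g f \<in> carrier ?N" if g: "g \<in> carrier G" and f: "f \<in> carrier ?N" for g f
  proof -
    have "{x \<in> X. ?p g f x \<noteq> \<one>\<^bsub>W\<^esub>} \<subseteq> \<phi> g ` {x \<in> X. f x \<noteq> \<one>\<^bsub>W\<^esub>}"
    proof
      fix x assume "x \<in> {x \<in> X. ?p g f x \<noteq> \<one>\<^bsub>W\<^esub>}"
      then have "x = \<phi> g (\<phi> (inv\<^bsub>G\<^esub> g) x)" "\<phi> (inv\<^bsub>G\<^esub> g) x \<in> {x \<in> X. f x \<noteq> \<one>\<^bsub>W\<^esub>}"
        using g by (auto simp: inv1 X)
      then show "x \<in> \<phi> g ` {x \<in> X. f x \<noteq> \<one>\<^bsub>W\<^esub>}" by (rule image_eqI)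
    qed
    then have "finite {x \<in> X. ?p g f x \<noteq> \<one>\<^bsub>W\<^esub>}"
      using f finite_surj unfolding carr by blast
    moreover have "?p g f \<in> X \<rightarrow>\<^sub>E carrier W"
      using g f by (auto simp: carr X PiE_iff)
    ultimately show ?thesis unfolding carr by blast
  qed
  have pcomp: "?p g (?p h f) = ?p (g \<otimes>\<^bsub>G\<^esub> h) f" if "g \<in> carrier G" "h \<in> carrier G" for g h f
    using that by (auto simp: G.inv_mult_group comp X intro!: restrict_ext)
  have pone: "?p \<one>\<^bsub>G\<^esub> f = f" if "f \<in> carrier ?N" for f
  proof
    fix x show "?p \<one>\<^bsub>G\<^esub> f x = f x"
      using that act.id_eq_one[symmetric] by (auto simp: carr PiE_iff extensional_def)
  qed
  have hom: "?p g \<in> hom ?N ?N" if "g \<in> carrier G" for g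
    using that closed by (auto simp: hom_def X intro!: restrict_ext)
  show ?thesis
    unfolding wreath_product_def
    by (rule group_semidirect_product[OF N G.is_group closed hom pcomp pone])
qed

section \<open>Free groups and finite presentability\<close>

text \<open>The free group on \<open>S\<close> consists of the reduced words in the letters \<open>(s, True)\<close>, standing
  for \<open>s\<close>, and \<open>(s, False)\<close>, standing for \<open>s\<inverse>\<close>.\<close>

definition letter_inv :: "'s \<times> bool \<Rightarrow> 's \<times> bool" where
  "letter_inv x = (fst x, \<not> snd x)"

definition reduced :: "('s \<times> bool) list \<Rightarrow> bool" where
  "reduced w \<longleftrightarrow> successively (\<lambda>x y. y \<noteq> letter_inv x) w"

fun cons_reduce :: "'s \<times> bool \<Rightarrow> ('s \<times> bool) list \<Rightarrow> ('s \<times> bool) list" where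
  "cons_reduce x [] = [x]"
| "cons_reduce x (y # w) = (if y = letter_inv x then w else x # y # w)"

definition free_group :: "'s set \<Rightarrow> ('s \<times> bool) list monoid" where
  "free_group S =
     \<lparr>carrier = {w. reduced w \<and> set w \<subseteq> S \<times> UNIV},
      monoid.mult = (\<lambda>u v. foldr cons_reduce u v),
      one = []\<rparr>"

lemma reduced_Cons:
  "reduced (x # w) \<longleftrightarrow> reduced w \<and> (w = [] \<or> hd w \<noteq> letter_inv x)"
  by (cases w) (auto simp: reduced_def)

lemma reduced_Nil [simp]: "reduced []"
  by (simp add: reduced_def)

lemma letter_inv_inv [simp]: "letter_inv (letter_inv x) = x"
  by (simp add: letter_inv_def)

lemma reduced_cons_reduce: "reduced w \<Longrightarrow> reduced (cons_reduce x w)"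
  by (cases w) (auto simp: reduced_Cons)

lemma reduced_foldr: "reduced v \<Longrightarrow> reduced (foldr cons_reduce u v)"
  by (induction u) (auto simp: reduced_cons_reduce)

lemma cons_reduce_cancel: "reduced w \<Longrightarrow> cons_reduce x (cons_reduce (letter_inv x) w) = w"
  by (cases w rule: remdups_adj.cases) (auto simp: reduced_def)

lemma foldr_cons_reduce:
  assumes "reduced w"
  shows "foldr cons_reduce (foldr cons_reduce u v) w = foldr cons_reduce u (foldr cons_reduce v w)"
proof (induction u)
  case (Cons x u)
  have "foldr cons_reduce (cons_reduce x v') w = cons_reduce x (foldr cons_reduce v' w)" for v'
    using cons_reduce_cancel[OF reduced_foldr[OF assms]] by (cases v') auto
  with Cons show ?case by simp
qed simp

lemma foldr_cons_reduce_Nil: "reduced w \<Longrightarrow> foldr cons_reduce w [] = w"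
proof (induction w)
  case (Cons x w)
  then show ?case by (cases w) (auto simp: reduced_Cons)
qed simp

lemma set_foldr_cons_reduce: "set (foldr cons_reduce u v) \<subseteq> set u \<union> set v"
proof (induction u)
  case (Cons x u)
  have "set (cons_reduce x w) \<subseteq> insert x (set w)" for w :: "('a \<times> bool) list"
    by (cases w) auto
  with Cons show ?case by fastforce
qed simp

lemma group_free_group: "group (free_group S)"
proof (rule groupI)
  fix u v assume "u \<in> carrier (free_group S)" "v \<in> carrier (free_group S)"
  then show "u \<otimes>\<^bsub>free_group S\<^esub> v \<in> carrier (free_group S)"
    using set_foldr_cons_reduce[of u v] by (auto simp: free_group_def reduced_foldr)
next
  fix w assume w: "w \<in> carrier (free_group S)"
  let ?i = "rev (map letter_inv w)"
  have l: "foldr cons_reduce (rev (map letter_inv w)) w = []"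
    for w :: "('a \<times> bool) list"
    by (induction w) auto
  let ?w' = "foldr cons_reduce ?i []"
  have "reduced ?w'" by (simp add: reduced_foldr)
  moreover have "set ?w' \<subseteq> S \<times> UNIV"
    using w set_foldr_cons_reduce[of ?i "[]"] by (fastforce simp: free_group_def letter_inv_def)
  moreover have "foldr cons_reduce ?w' w = []"
    using w by (simp add: foldr_cons_reduce free_group_def l)
  ultimately show "\<exists>v\<in>carrier (free_group S). v \<otimes>\<^bsub>free_group S\<^esub> w = \<one>\<^bsub>free_group S\<^esub>"
    by (intro bexI[of _ ?w']) (auto simp: free_group_def)
qed (auto simp: free_group_def foldr_cons_reduce)

definition normal_closure :: "('g, 'c) monoid_scheme \<Rightarrow> 'g set \<Rightarrow> 'g set" where
  "normal_closure G R = \<Inter>{N. N \<lhd> G \<and> R \<subseteq> N}"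

text \<open>A finite generating set may be relabelled as \<open>{..<n}\<close>.\<close>

definition finitely_presented :: "('g, 'c) monoid_scheme \<Rightarrow> bool" where
  "finitely_presented G \<longleftrightarrow>
     (\<exists>(n::nat) R. finite R \<and> R \<subseteq> carrier (free_group {..<n}) \<and>
        G \<cong> free_group {..<n} Mod normal_closure (free_group {..<n}) R)"

end

theory Submission
  imports Defs "HOL-Combinatorics.Transposition"
begin

text \<open>
  If \<open>W \<wr>\<^sub>X G\<close> is finitely presented, then \<open>G\<close> has finitely many orbits on \<open>X \<times> X\<close>: otherwise pick
  \<open>x \<noteq> y\<close> whose orbit avoids the finitely many pairs involved in the relators, and let \<open>W\<^sub>x\<close> and \<open>W\<^sub>y\<close>
  (and, equivariantly, their translates) act by two non-commuting actions of \<open>W\<close>. The relators still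
  hold, so the generators of \<open>W \<wr>\<^sub>X G\<close> would act in a way that makes \<open>W\<^sub>x\<close> and \<open>W\<^sub>y\<close> commute.

  Now let a branch group \<open>G\<close> act on \<open>X\<close> with finitely many orbits of pairs. Any equivariant
  assignment of nonempty sets of at most \<open>b\<close> vertices of level \<open>j\<close> to points of \<open>X\<close> forces \<open>j\<close> to be
  bounded in terms of \<open>b\<close>, because the lengths of common prefixes of vertices assigned to \<open>x\<close> and \<open>y\<close>
  depend only on the orbit of \<open>(x, y)\<close>. Finiteness also shows that for deep vertices \<open>v\<close>, every point of
  \<open>Rist(v) x\<close> lies in \<open>Rist(u) x\<close> for some \<open>u\<close> on any prescribed level. Combining the two, one
  finds first that point stabilizers in \<open>Rist(v)\<close> are normal, and then that \<open>Rist(v)\<close> acts as an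
  abelian group, for all \<open>v\<close> of some level \<open>n\<close>. So the finite index subgroup \<open>Rist(n)\<close> acts through
  an abelian group, and an abelian group with finitely many orbits of pairs has finite orbits.
\<close>

section \<open>The universal property of a finite presentation\<close>

definition letter_val :: "('g, 'c) monoid_scheme \<Rightarrow> ('s \<Rightarrow> 'g) \<Rightarrow> 's \<times> bool \<Rightarrow> 'g" where
  "letter_val H \<delta> l = (if snd l then \<delta> (fst l) else inv\<^bsub>H\<^esub> (\<delta> (fst l)))"

definition word_val :: "('g, 'c) monoid_scheme \<Rightarrow> ('s \<Rightarrow> 'g) \<Rightarrow> ('s \<times> bool) list \<Rightarrow> 'g" where
  "word_val H \<delta> w = foldr (\<lambda>l. (\<otimes>\<^bsub>H\<^esub>) (letter_val H \<delta> l)) w \<one>\<^bsub>H\<^esub>"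

lemma word_val_simps [simp]:
  "word_val H \<delta> [] = \<one>\<^bsub>H\<^esub>"
  "word_val H \<delta> (l # w) = letter_val H \<delta> l \<otimes>\<^bsub>H\<^esub> word_val H \<delta> w"
  by (simp_all add: word_val_def)

context group begin

lemma letter_val_closed:
  "\<lbrakk>\<delta> \<in> S \<rightarrow> carrier G; l \<in> S \<times> UNIV\<rbrakk> \<Longrightarrow> letter_val G \<delta> l \<in> carrier G"
  by (auto simp: letter_val_def)

lemma word_val_closed:
  "\<lbrakk>\<delta> \<in> S \<rightarrow> carrier G; set w \<subseteq> S \<times> UNIV\<rbrakk> \<Longrightarrow> word_val G \<delta> w \<in> carrier G"
  by (induction w) (simp_all add: letter_val_closed)

lemma word_val_cons_reduce:
  assumes "\<delta> \<in> S \<rightarrow> carrier G" "l \<in> S \<times> UNIV" "set w \<subseteq> S \<times> UNIV"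
  shows "word_val G \<delta> (cons_reduce l w) = letter_val G \<delta> l \<otimes> word_val G \<delta> w"
proof (cases w)
  case (Cons k u)
  have c: "word_val G \<delta> u \<in> carrier G" "\<delta> (fst l) \<in> carrier G"
    using assms Cons by (auto intro: word_val_closed)
  show ?thesis
    using c by (simp add: Cons letter_val_def letter_inv_def m_assoc[symmetric])
qed simp

lemma word_val_hom:
  assumes "\<delta> \<in> S \<rightarrow> carrier G"
  shows "word_val G \<delta> \<in> hom (free_group S) G"
proof -
  have "word_val G \<delta> (foldr cons_reduce u v) = word_val G \<delta> u \<otimes> word_val G \<delta> v"
    if "set u \<subseteq> S \<times> UNIV" "set v \<subseteq> S \<times> UNIV" for u v
    using that(1)
  proof (induction u)
    case Nil
    then show ?case using word_val_closed[OF assms that(2)] by simp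
  next
    case (Cons l u)
    have "set (foldr cons_reduce u v) \<subseteq> S \<times> UNIV"
      using set_foldr_cons_reduce[of u v] Cons.prems that(2) by auto
    moreover have "letter_val G \<delta> l \<in> carrier G" "word_val G \<delta> u \<in> carrier G"
      "word_val G \<delta> v \<in> carrier G"
      using Cons.prems that(2) by (auto intro!: word_val_closed[OF assms] letter_val_closed[OF assms])
    ultimately show ?case
      using Cons word_val_cons_reduce[OF assms, of l] by (simp add: m_assoc)
  qed
  then show ?thesis
    by (auto simp: hom_def free_group_def intro!: word_val_closed[OF assms])
qed

end

lemma hom_word_val:
  assumes "group G" "group H" "s \<in> hom G H" "\<gamma> \<in> S \<rightarrow> carrier G" "set w \<subseteq> S \<times> UNIV"
  shows "s (word_val G \<gamma> w) = word_val H (s \<circ> \<gamma>) w"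
proof -
  interpret group_hom G H s
    using assms by (simp add: group_hom_def group_hom_axioms_def)
  have "s (letter_val G \<gamma> l) = letter_val H (s \<circ> \<gamma>) l" if "l \<in> S \<times> UNIV" for l
    using that assms(4) by (auto simp: letter_val_def Pi_iff)
  with assms(5) show ?thesis
    by (induction w) (auto simp: G.letter_val_closed[OF assms(4)] G.word_val_closed[OF assms(4)])
qed

lemma word_val_cong: "\<lbrakk>\<And>i. i \<in> S \<Longrightarrow> \<gamma> i = \<delta> i; set w \<subseteq> S \<times> UNIV\<rbrakk> \<Longrightarrow> word_val G \<gamma> w = word_val G \<delta> w"
  by (induction w) (auto simp: letter_val_def)

text \<open>Prepending a letter to a reduced word so that it stays reduced never triggers the
  cancelling case of \<open>cons_reduce\<close>, so multiplying out the letters gives back the word.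
  This lets the map onto the presented group be written as \<open>word_val\<close>.\<close>

lemma free_group_word_val:
  assumes "w \<in> carrier (free_group S)"
  shows "word_val (free_group S) (\<lambda>s. [(s, True)]) w = w"
proof -
  interpret F: group "free_group S" by (rule group_free_group)
  have l: "letter_val (free_group S) (\<lambda>s. [(s, True)]) l = [l]" if "l \<in> S \<times> UNIV" for l
  proof (cases "snd l")
    case False
    have "inv\<^bsub>free_group S\<^esub> [(fst l, True)] = [l]"
      using that False
      by (intro F.inv_equality) (auto simp: free_group_def letter_inv_def reduced_def prod_eq_iff)
    then show ?thesis using False by (simp add: letter_val_def)
  qed (use that in \<open>auto simp: letter_val_def prod_eq_iff\<close>)
  show ?thesis using assms
  proof (induction w)
    case (Cons x w)
    then have "w \<in> carrier (free_group S)" "x \<in> S \<times> UNIV" "w = [] \<or> hd w \<noteq> letter_inv x"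
      by (auto simp: free_group_def reduced_Cons)
    then show ?case using Cons l[of x] by (cases w) (auto simp: free_group_def)
  qed (simp add: free_group_def)
qed

lemma normal_closure_normal:
  assumes "group G" "R \<subseteq> carrier G"
  shows "normal_closure G R \<lhd> G" "R \<subseteq> normal_closure G R"
proof -
  interpret group G by fact
  let ?\<N> = "{N. N \<lhd> G \<and> R \<subseteq> N}"
  have "carrier G \<in> ?\<N>" 
    using assms by (auto intro!: normal_invI subgroup_self)
  then have ne: "?\<N> \<noteq> {}" by blast
  have "subgroup (\<Inter>?\<N>) G"
    using ne by (intro subgroups_Inter) (auto dest: normal_imp_subgroup)
  then show "normal_closure G R \<lhd> G"
    unfolding normal_closure_def by (rule normal_invI) (auto simp: normal_inv_iff)
  show "R \<subseteq> normal_closure G R" by (auto simp: normal_closure_def)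
qed

text \<open>The generators are the images of the free generators under an isomorphism from the
  quotient. The last clause is von Dyck's theorem; the element type \<open>'h\<close> of its target
  is chosen when the rule is applied.\<close>

lemma finitely_presentedE:
  fixes \<Gamma> :: "('g, 'c) monoid_scheme"
  assumes "group \<Gamma>" "finitely_presented \<Gamma>"
  obtains n :: nat and \<gamma> R where "\<gamma> \<in> {..<n} \<rightarrow> carrier \<Gamma>" "finite R"
    "\<And>r. r \<in> R \<Longrightarrow> set r \<subseteq> {..<n} \<times> UNIV \<and> word_val \<Gamma> \<gamma> r = \<one>\<^bsub>\<Gamma>\<^esub>"
    "\<And>g. g \<in> carrier \<Gamma> \<Longrightarrow> \<exists>w. set w \<subseteq> {..<n} \<times> UNIV \<and> word_val \<Gamma> \<gamma> w = g"
    "\<And>(H :: 'h monoid) \<delta>. \<lbrakk>group H; \<delta> \<in> {..<n} \<rightarrow> carrier H; \<forall>r\<in>R. word_val H \<delta> r = \<one>\<^bsub>H\<^esub>\<rbrakk>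
       \<Longrightarrow> \<exists>s\<in>hom \<Gamma> H. \<forall>i<n. s (\<gamma> i) = \<delta> i"
proof -
  obtain n :: nat and R where R: "finite R" "R \<subseteq> carrier (free_group {..<n})"
    and iso: "\<Gamma> \<cong> free_group {..<n} Mod normal_closure (free_group {..<n}) R"
    using assms(2) by (auto simp: finitely_presented_def)
  let ?F = "free_group {..<n}"
  let ?N = "normal_closure ?F R"
  interpret F: group ?F by (rule group_free_group)
  interpret \<Gamma>: group \<Gamma> by fact
  note N = normal_closure_normal[OF F.is_group R(2)]
  interpret N: normal ?N ?F by (rule N(1))
  interpret Q: group "?F Mod ?N" by (rule N.factorgroup_is_group)
  obtain \<theta> where \<theta>: "\<theta> \<in> iso (?F Mod ?N) \<Gamma>"
    using \<Gamma>.iso_sym[OF iso] by (auto simp: is_iso_def)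
  define \<pi> where "\<pi> w = \<theta> (?N #>\<^bsub>?F\<^esub> w)" for w
  define \<gamma> where "\<gamma> i = \<pi> [(i, True)]" for i
  have \<pi>: "\<pi> \<in> hom ?F \<Gamma>"
    using hom_compose[OF N.r_coset_hom_Mod, of \<theta> \<Gamma>] \<theta>
    unfolding iso_def \<pi>_def[abs_def] comp_def by blast
  have gen: "(\<lambda>s. [(s, True)]) \<in> {..<n} \<rightarrow> carrier ?F"
    by (auto simp: free_group_def reduced_def)
  have \<gamma>: "\<gamma> \<in> {..<n} \<rightarrow> carrier \<Gamma>"
    using gen hom_in_carrier[OF \<pi>] by (auto simp: \<gamma>_def Pi_iff)
  have \<pi>_eq: "\<pi> w = word_val \<Gamma> \<gamma> w" if "w \<in> carrier ?F" for w
  proof -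
    have "\<pi> w = \<pi> (word_val ?F (\<lambda>s. [(s, True)]) w)"
      using free_group_word_val[OF that] by simp
    also have "\<dots> = word_val \<Gamma> \<gamma> w"
      using that hom_word_val[OF F.is_group \<Gamma>.is_group \<pi> gen, of w]
      by (simp add: \<gamma>_def[abs_def] comp_def) (simp add: free_group_def)
    finally show ?thesis .
  qed
  show ?thesis
  proof (rule that[OF \<gamma> R(1)])
    fix r assume r: "r \<in> R"
    then have rF: "r \<in> carrier ?F" using R(2) by blast
    have "?N #>\<^bsub>?F\<^esub> r = ?N"
      using r N(2) by (intro F.coset_join2[OF rF N.subgroup_axioms]) auto
    then have "\<pi> r = \<one>\<^bsub>\<Gamma>\<^esub>"
      using hom_one[of \<theta> "?F Mod ?N" \<Gamma>] \<theta> Q.is_group by (simp add: \<pi>_def iso_def)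
    then show "set r \<subseteq> {..<n} \<times> UNIV \<and> word_val \<Gamma> \<gamma> r = \<one>\<^bsub>\<Gamma>\<^esub>"
      using rF \<pi>_eq[OF rF] by (auto simp: free_group_def)
  next
    fix g assume "g \<in> carrier \<Gamma>"
    moreover have "\<theta> ` carrier (?F Mod ?N) = carrier \<Gamma>"
      using \<theta> by (simp add: iso_def bij_betw_def)
    ultimately obtain c where "c \<in> carrier (?F Mod ?N)" "\<theta> c = g"
      by (metis imageE)
    then obtain w where "w \<in> carrier ?F" "\<pi> w = g"
      by (auto simp: carrier_FactGroup \<pi>_def)
    then show "\<exists>w. set w \<subseteq> {..<n} \<times> UNIV \<and> word_val \<Gamma> \<gamma> w = g"
      using \<pi>_eq by (auto simp: free_group_def)
  next
    fix H :: "'h monoid" and \<delta>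
    assume H: "group H" and \<delta>: "\<delta> \<in> {..<n} \<rightarrow> carrier H"
      and rel: "\<forall>r\<in>R. word_val H \<delta> r = \<one>\<^bsub>H\<^esub>"
    interpret H: group H by fact
    interpret v: group_hom ?F H "word_val H \<delta>"
      using H.word_val_hom[OF \<delta>] by (simp add: group_hom_def group_hom_axioms_def F.is_group)
    \<comment> \<open>The kernel of evaluation in \<open>H\<close> is normal and contains the
      relators, hence also their normal closure, so evaluation is constant on cosets and factors
      through the quotient.\<close>
    have "R \<subseteq> kernel ?F H (word_val H \<delta>)"
      using R(2) rel by (auto simp: kernel_def)
    then have "?N \<subseteq> kernel ?F H (word_val H \<delta>)"
      using v.normal_kernel unfolding normal_closure_def by blast
    then have eq: "word_val H \<delta> x = word_val H \<delta> y"
      if "x \<in> carrier ?F" "y \<in> carrier ?F" "?N #>\<^bsub>?F\<^esub> x = ?N #>\<^bsub>?F\<^esub> y" for x y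
    proof -
      have "x \<in> ?N #>\<^bsub>?F\<^esub> y"
        using F.rcos_self[OF that(1) N.subgroup_axioms] that(3) by simp
      then obtain k where "k \<in> ?N" "x = k \<otimes>\<^bsub>?F\<^esub> y" by (auto simp: r_coset_def)
      with that(2) \<open>?N \<subseteq> _\<close> show ?thesis by (auto simp: kernel_def)
    qed
    obtain s where s: "s \<in> hom (?F Mod ?N) H" "\<And>x. x \<in> carrier ?F \<Longrightarrow> s (?N #>\<^bsub>?F\<^esub> x) = word_val H \<delta> x"
      using FactGroup_universal[OF v.homh N(1) eq] by blast
    define \<theta>' where "\<theta>' = inv_into (carrier (?F Mod ?N)) \<theta>"
    have "\<theta>' \<in> hom \<Gamma> (?F Mod ?N)"
      using Q.iso_set_sym[OF \<theta>] by (auto simp: iso_def \<theta>'_def)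
    then have "s \<circ> \<theta>' \<in> hom \<Gamma> H" using s(1) by (rule hom_compose)
    moreover have "(s \<circ> \<theta>') (\<gamma> i) = \<delta> i" if "i < n" for i
    proof -
      have i: "[(i, True)] \<in> carrier ?F" using gen that by (auto simp: Pi_iff)
      then have "\<theta>' (\<gamma> i) = ?N #>\<^bsub>?F\<^esub> [(i, True)]"
        using \<theta> unfolding \<theta>'_def \<gamma>_def \<pi>_def
        by (intro inv_into_f_f) (auto simp: iso_def bij_betw_def carrier_FactGroup)
      then show ?thesis using s(2)[OF i] \<delta> that by (auto simp: letter_val_def Pi_iff)
    qed
    ultimately show "\<exists>s\<in>hom \<Gamma> H. \<forall>i<n. s (\<gamma> i) = \<delta> i" by blast
  qed
qed

section \<open>Finitely presented permutational wreath products\<close>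

locale perm_wreath = W: group W + act: group_action M X \<phi>
  for W :: "('w, 'm) monoid_scheme" and M :: "('g, 'd) monoid_scheme" and X :: "'x set" and \<phi>
begin

sublocale M: group M
  using act.group_hom by (simp add: group_hom_def)

abbreviation \<Gamma> where "\<Gamma> \<equiv> wreath_product W X \<phi> M"

sublocale \<Gamma>: group \<Gamma>
  by (rule group_wreath_product) unfold_locales

lemma act_closed [simp]: "\<lbrakk>g \<in> carrier M; x \<in> X\<rbrakk> \<Longrightarrow> \<phi> g x \<in> X"
  using act.element_image by blast

lemma act_one [simp]: "x \<in> X \<Longrightarrow> \<phi> \<one>\<^bsub>M\<^esub> x = x"
  using act.id_eq_one by (metis restrict_apply')

lemmas act_mult = act.composition_rule

lemma act_inv [simp]:
  assumes "g \<in> carrier M" "x \<in> X"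
  shows "\<phi> g (\<phi> (inv\<^bsub>M\<^esub> g) x) = x" "\<phi> (inv\<^bsub>M\<^esub> g) (\<phi> g x) = x"
  using assms by (simp_all flip: act_mult)

lemma carrier_wreath:
  "(f, g) \<in> carrier \<Gamma> \<longleftrightarrow> f \<in> X \<rightarrow>\<^sub>E carrier W \<and> finite {x \<in> X. f x \<noteq> \<one>\<^bsub>W\<^esub>} \<and> g \<in> carrier M"
  by (auto simp: wreath_product_def semidirect_product_def carrier_sum_group W.is_group)

lemma mult_wreath:
  "(f, g) \<otimes>\<^bsub>\<Gamma>\<^esub> (f', g') = (\<lambda>x\<in>X. f x \<otimes>\<^bsub>W\<^esub> f' (\<phi> (inv\<^bsub>M\<^esub> g) x), g \<otimes>\<^bsub>M\<^esub> g')"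
  by (auto simp: wreath_product_def semidirect_product_def)

lemma one_wreath: "\<one>\<^bsub>\<Gamma>\<^esub> = (\<lambda>x\<in>X. \<one>\<^bsub>W\<^esub>, \<one>\<^bsub>M\<^esub>)"
  by (simp add: wreath_product_def semidirect_product_def)

section \<open>Elements supported at one coordinate and lifts of group elements\<close>

definition base :: "'x \<Rightarrow> 'w \<Rightarrow> ('x \<Rightarrow> 'w) \<times> 'g" where
  "base x w = (\<lambda>y\<in>X. if y = x then w else \<one>\<^bsub>W\<^esub>, \<one>\<^bsub>M\<^esub>)"

definition top :: "'g \<Rightarrow> ('x \<Rightarrow> 'w) \<times> 'g" where
  "top g = (\<lambda>y\<in>X. \<one>\<^bsub>W\<^esub>, g)"

lemma base_closed [simp]: "w \<in> carrier W \<Longrightarrow> base x w \<in> carrier \<Gamma>"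
  by (auto simp: base_def carrier_wreath intro: finite_subset[of _ "{x}"])

lemma top_closed [simp]: "g \<in> carrier M \<Longrightarrow> top g \<in> carrier \<Gamma>"
  by (auto simp: top_def carrier_wreath)

lemma top_mult: "\<lbrakk>g \<in> carrier M; h \<in> carrier M\<rbrakk> \<Longrightarrow> top (g \<otimes>\<^bsub>M\<^esub> h) = top g \<otimes>\<^bsub>\<Gamma>\<^esub> top h"
  by (auto simp: top_def mult_wreath cong: restrict_cong)

lemma base_mult:
  "\<lbrakk>v \<in> carrier W; w \<in> carrier W\<rbrakk> \<Longrightarrow> base x (v \<otimes>\<^bsub>W\<^esub> w) = base x v \<otimes>\<^bsub>\<Gamma>\<^esub> base x w"
  by (auto simp: base_def mult_wreath cong: restrict_cong)

lemma base_conj: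
  assumes "g \<in> carrier M" "x \<in> X" "w \<in> carrier W"
  shows "top g \<otimes>\<^bsub>\<Gamma>\<^esub> base x w = base (\<phi> g x) w \<otimes>\<^bsub>\<Gamma>\<^esub> top g"
proof -
  have "\<phi> (inv\<^bsub>M\<^esub> g) y = x \<longleftrightarrow> y = \<phi> g x" if "y \<in> X" for y
    using assms that by auto
  then show ?thesis
    using assms by (auto simp: base_def top_def mult_wreath cong: restrict_cong)
qed

lemma base_commute:
  assumes "x \<noteq> y" "v \<in> carrier W" "w \<in> carrier W"
  shows "base x v \<otimes>\<^bsub>\<Gamma>\<^esub> base y w = base y w \<otimes>\<^bsub>\<Gamma>\<^esub> base x v"
  using assms by (auto simp: base_def mult_wreath cong: restrict_cong)

text \<open>\<open>W\<close> acts on \<open>W\<close> with an added fixed point \<open>None\<close> by left multiplication. Conjugating by the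
  transposition of \<open>None\<close> and \<open>1\<close> gives a second action that does not commute with the first.\<close>

definition pts :: "'w option set" where "pts = insert None (Some ` carrier W)"

definition left_act :: "'w \<Rightarrow> 'w option \<Rightarrow> 'w option" where
  "left_act w = map_option (\<lambda>v. w \<otimes>\<^bsub>W\<^esub> v)"

definition flip :: "'w option \<Rightarrow> 'w option" where
  "flip = transpose None (Some \<one>\<^bsub>W\<^esub>)"

definition left_act' :: "'w \<Rightarrow> 'w option \<Rightarrow> 'w option" where
  "left_act' w z = flip (left_act w (flip z))"

lemma flip_closed [simp]: "z \<in> pts \<Longrightarrow> flip z \<in> pts"
  by (auto simp: flip_def pts_def transpose_def)

lemma flip_flip [simp]: "flip (flip z) = z"
  by (simp add: flip_def)

lemma left_act_closed [simp]:
  "\<lbrakk>w \<in> carrier W; z \<in> pts\<rbrakk> \<Longrightarrow> left_act w z \<in> pts"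
  "\<lbrakk>w \<in> carrier W; z \<in> pts\<rbrakk> \<Longrightarrow> left_act' w z \<in> pts"
proof -
  show *: "left_act w z \<in> pts" if "w \<in> carrier W" "z \<in> pts" for w z
    using that by (auto simp: left_act_def pts_def)
  show "\<lbrakk>w \<in> carrier W; z \<in> pts\<rbrakk> \<Longrightarrow> left_act' w z \<in> pts"
    by (simp add: * left_act'_def)
qed

lemma left_act_one [simp]:
  "z \<in> pts \<Longrightarrow> left_act \<one>\<^bsub>W\<^esub> z = z"  "z \<in> pts \<Longrightarrow> left_act' \<one>\<^bsub>W\<^esub> z = z"
proof -
  show *: "left_act \<one>\<^bsub>W\<^esub> z = z" if "z \<in> pts" for z
    using that by (auto simp: left_act_def pts_def)
  show "z \<in> pts \<Longrightarrow> left_act' \<one>\<^bsub>W\<^esub> z = z"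
    by (simp add: * left_act'_def)
qed

lemma left_act_mult:
  "\<lbrakk>v \<in> carrier W; w \<in> carrier W; z \<in> pts\<rbrakk> \<Longrightarrow> left_act (v \<otimes>\<^bsub>W\<^esub> w) z = left_act v (left_act w z)"
  "\<lbrakk>v \<in> carrier W; w \<in> carrier W; z \<in> pts\<rbrakk> \<Longrightarrow> left_act' (v \<otimes>\<^bsub>W\<^esub> w) z = left_act' v (left_act' w z)"
proof -
  show *: "left_act (v \<otimes>\<^bsub>W\<^esub> w) z = left_act v (left_act w z)"
    if "v \<in> carrier W" "w \<in> carrier W" "z \<in> pts" for v w z
    using that by (auto simp: left_act_def pts_def W.m_assoc)
  show "\<lbrakk>v \<in> carrier W; w \<in> carrier W; z \<in> pts\<rbrakk>
      \<Longrightarrow> left_act' (v \<otimes>\<^bsub>W\<^esub> w) z = left_act' v (left_act' w z)"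
    by (simp add: * left_act'_def)
qed

lemma left_act_inv [simp]:
  assumes "w \<in> carrier W" "z \<in> pts"
  shows "left_act w (left_act (inv\<^bsub>W\<^esub> w) z) = z" "left_act (inv\<^bsub>W\<^esub> w) (left_act w z) = z"
    "left_act' w (left_act' (inv\<^bsub>W\<^esub> w) z) = z" "left_act' (inv\<^bsub>W\<^esub> w) (left_act' w z) = z"
  using assms by (simp_all flip: left_act_mult)

text \<open>The test point \<open>Some 1\<close> is fixed by \<open>left_act' w\<close>, since
  \<open>flip\<close> sends it to the fixed point \<open>None\<close>. One order therefore gives
  \<open>Some w\<close>, the other \<open>flip (Some (w w))\<close>, and these differ because
  \<open>w w\<close> is not \<open>w\<close>.\<close>

lemma left_acts_do_not_commute:
  assumes "w \<in> carrier W" "w \<noteq> \<one>\<^bsub>W\<^esub>"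
  shows "left_act w (left_act' w (Some \<one>\<^bsub>W\<^esub>)) \<noteq> left_act' w (left_act w (Some \<one>\<^bsub>W\<^esub>))"
proof -
  have "w \<otimes>\<^bsub>W\<^esub> w \<noteq> w" using assms by (metis W.r_cancel_one)
  then show ?thesis
    using assms by (auto simp: left_act'_def left_act_def flip_def transpose_def)
qed

text \<open>There is one copy of \<open>pts\<close> for every group element. The left regular action
  permutes the copies, so each copy can be tied to one translate of the pair \<open>x\<close>,
  \<open>y\<close>.\<close>

definition space :: "('g \<times> 'w option) set" where "space = carrier M \<times> pts"

text \<open>An element \<open>(f, g)\<close> translates the coordinate \<open>h \<in> G\<close> to \<open>k = g h\<close> and acts there by \<open>f (k x)\<close>
  and \<open>f (k y)\<close> through the two actions. This is not a homomorphism, but it multiplies correctly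
  on pairs of elements whose supports are not met simultaneously by a translate of \<open>{x, y}\<close>.\<close>

definition shuffle :: "'x \<Rightarrow> 'x \<Rightarrow> ('x \<Rightarrow> 'w) \<times> 'g \<Rightarrow> 'g \<times> 'w option \<Rightarrow> 'g \<times> 'w option" where
  "shuffle x y p = (\<lambda>(h, z)\<in>space.
     let k = snd p \<otimes>\<^bsub>M\<^esub> h in (k, left_act (fst p (\<phi> k x)) (left_act' (fst p (\<phi> k y)) z)))"

lemma fst_closed: "\<lbrakk>p \<in> carrier \<Gamma>; x \<in> X\<rbrakk> \<Longrightarrow> fst p x \<in> carrier W"
  by (cases p) (auto simp: carrier_wreath)

lemma snd_closed: "p \<in> carrier \<Gamma> \<Longrightarrow> snd p \<in> carrier M"
  by (cases p) (auto simp: carrier_wreath)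

lemma shuffle_closed:
  assumes "x \<in> X" "y \<in> X" "p \<in> carrier \<Gamma>"
  shows "shuffle x y p \<in> carrier (BijGroup space)"
proof -
  let ?f = "fst p" and ?g = "snd p"
  note c = fst_closed[OF assms(3)] snd_closed[OF assms(3)]
  let ?inv = "\<lambda>(k, z). (inv\<^bsub>M\<^esub> ?g \<otimes>\<^bsub>M\<^esub> k,
    left_act' (inv\<^bsub>W\<^esub> (?f (\<phi> k y))) (left_act (inv\<^bsub>W\<^esub> (?f (\<phi> k x))) z))"
  have "bij_betw (shuffle x y p) space space"
    by (rule bij_betw_byWitness[where f' = ?inv])
      (use c assms in \<open>auto simp: shuffle_def space_def Let_def M.m_assoc[symmetric]\<close>)
  then show ?thesis by (simp add: BijGroup_def Bij_def shuffle_def)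
qed

text \<open>In the composition the \<open>left_act'\<close> factor of \<open>p\<close> stands to the
  left of the \<open>left_act\<close> factor of \<open>q\<close>; in the shuffle of the product
  these two are interchanged. Both orders agree when one of the two factors is trivial, which
  \<open>triv\<close> guarantees for every \<open>k\<close>.\<close>

lemma shuffle_mult:
  assumes "x \<in> X" "y \<in> X" "p \<in> carrier \<Gamma>" "q \<in> carrier \<Gamma>"
    and triv: "\<And>k. k \<in> carrier M \<Longrightarrow>
      fst p (\<phi> k y) = \<one>\<^bsub>W\<^esub> \<or> fst q (\<phi> (inv\<^bsub>M\<^esub> (snd p)) (\<phi> k x)) = \<one>\<^bsub>W\<^esub>"
  shows "shuffle x y (p \<otimes>\<^bsub>\<Gamma>\<^esub> q) = shuffle x y p \<otimes>\<^bsub>BijGroup space\<^esub> shuffle x y q"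
proof -
  obtain f g f' g' where pq: "p = (f, g)" "q = (f', g')" by fastforce
  note c = fst_closed[OF assms(3)] snd_closed[OF assms(3)] fst_closed[OF assms(4)] snd_closed[OF assms(4)]
  have eq: "shuffle x y (p \<otimes>\<^bsub>\<Gamma>\<^esub> q) (h, z) = shuffle x y p (shuffle x y q (h, z))"
    if h: "h \<in> carrier M" "z \<in> pts" for h z
  proof -
    let ?k = "g \<otimes>\<^bsub>M\<^esub> (g' \<otimes>\<^bsub>M\<^esub> h)"
    have k: "?k \<in> carrier M" using c h pq by auto
    have inv: "\<phi> (inv\<^bsub>M\<^esub> g) (\<phi> ?k u) = \<phi> (g' \<otimes>\<^bsub>M\<^esub> h) u" if "u \<in> X" for u
      using c h pq that by (simp add: act_mult)
    show ?thesis
      using triv[OF k] c h k assms(1,2) unfolding pq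
      by (auto simp: mult_wreath shuffle_def space_def Let_def M.m_assoc left_act_mult inv)
  qed
  have "shuffle x y p \<otimes>\<^bsub>BijGroup space\<^esub> shuffle x y q = compose space (shuffle x y p) (shuffle x y q)"
    using shuffle_closed[OF assms(1,2,3)] shuffle_closed[OF assms(1,2,4)] by (simp add: BijGroup_def)
  moreover have "shuffle x y (p \<otimes>\<^bsub>\<Gamma>\<^esub> q) = compose space (shuffle x y p) (shuffle x y q)"
  proof (rule extensionalityI[of _ space])
    fix a assume "a \<in> space"
    then show "shuffle x y (p \<otimes>\<^bsub>\<Gamma>\<^esub> q) a = compose space (shuffle x y p) (shuffle x y q) a"
      using eq by (auto simp: compose_def space_def)
  qed (auto simp: shuffle_def)
  ultimately show ?thesis by simp
qed

lemma fst_snd_simps [simp]: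
  "u \<in> X \<Longrightarrow> fst (base x w) u = (if u = x then w else \<one>\<^bsub>W\<^esub>)" "snd (base x w) = \<one>\<^bsub>M\<^esub>"
  "u \<in> X \<Longrightarrow> fst (top g) u = \<one>\<^bsub>W\<^esub>" "snd (top g) = g"
  "u \<in> X \<Longrightarrow> fst \<one>\<^bsub>\<Gamma>\<^esub> u = \<one>\<^bsub>W\<^esub>" "snd \<one>\<^bsub>\<Gamma>\<^esub> = \<one>\<^bsub>M\<^esub>"
  by (simp_all add: base_def top_def one_wreath)

section \<open>Relations preserved by shuffles of pairs whose orbit avoids a finite square\<close>

definition spread :: "'x set \<Rightarrow> 'x \<Rightarrow> 'x \<Rightarrow> bool" where
  "spread S x y \<longleftrightarrow> x \<in> X \<and> y \<in> X \<and> (\<forall>k\<in>carrier M. \<phi> k x \<notin> S \<or> \<phi> k y \<notin> S)"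

lemma spread_mono: "\<lbrakk>spread S x y; S' \<subseteq> S\<rbrakk> \<Longrightarrow> spread S' x y"
  by (auto simp: spread_def)

text \<open>If \<open>triv\<close> failed at \<open>k\<close>, then \<open>k y\<close> would lie in
  the support of \<open>p\<close> and \<open>k x\<close> in the support of \<open>q\<close>
  translated by \<open>snd p\<close>. The set \<open>S\<close> depends on \<open>p\<close> and
  \<open>q\<close> but not on \<open>x\<close> and \<open>y\<close>, so finitely many products can
  share one set.\<close>

lemma shuffle_mult_spread:
  assumes "p \<in> carrier \<Gamma>" "q \<in> carrier \<Gamma>"
  shows "\<exists>S. finite S \<and> S \<subseteq> X \<and> (\<forall>x y. spread S x y \<longrightarrow>
    shuffle x y (p \<otimes>\<^bsub>\<Gamma>\<^esub> q) = shuffle x y p \<otimes>\<^bsub>BijGroup space\<^esub> shuffle x y q)"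
proof -
  note g = snd_closed[OF assms(1)]
  let ?S = "{u \<in> X. fst p u \<noteq> \<one>\<^bsub>W\<^esub>} \<union> \<phi> (snd p) ` {u \<in> X. fst q u \<noteq> \<one>\<^bsub>W\<^esub>}"
  have "finite ?S"
    using assms by (cases p, cases q) (auto simp: carrier_wreath)
  moreover have "?S \<subseteq> X" using g by auto
  moreover have "shuffle x y (p \<otimes>\<^bsub>\<Gamma>\<^esub> q) = shuffle x y p \<otimes>\<^bsub>BijGroup space\<^esub> shuffle x y q"
    if "spread ?S x y" for x y
  proof (rule shuffle_mult[OF _ _ assms])
    fix k assume k: "k \<in> carrier M"
    have xy: "x \<in> X" "y \<in> X" using that by (auto simp: spread_def)
    have "\<phi> k x = \<phi> (snd p) (\<phi> (inv\<^bsub>M\<^esub> (snd p)) (\<phi> k x))" 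
      using g k xy by simp
    moreover have "\<phi> (inv\<^bsub>M\<^esub> (snd p)) (\<phi> k x) \<in> X" using g k xy by simp
    ultimately have "\<phi> k x \<in> ?S" if "fst q (\<phi> (inv\<^bsub>M\<^esub> (snd p)) (\<phi> k x)) \<noteq> \<one>\<^bsub>W\<^esub>"
      using that by blast
    then show "fst p (\<phi> k y) = \<one>\<^bsub>W\<^esub> \<or> fst q (\<phi> (inv\<^bsub>M\<^esub> (snd p)) (\<phi> k x)) = \<one>\<^bsub>W\<^esub>"
      using that k xy unfolding spread_def by fastforce
  qed (use that in \<open>auto simp: spread_def\<close>)
  ultimately show ?thesis by blast
qed

lemma shuffle_one:
  assumes "x \<in> X" "y \<in> X"
  shows "shuffle x y \<one>\<^bsub>\<Gamma>\<^esub> = \<one>\<^bsub>BijGroup space\<^esub>"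
  using assms
  by (auto simp: shuffle_def one_wreath BijGroup_def space_def Let_def intro!: restrict_ext)

lemma shuffle_inv_spread:
  assumes "p \<in> carrier \<Gamma>"
  shows "\<exists>S. finite S \<and> S \<subseteq> X \<and> (\<forall>x y. spread S x y \<longrightarrow>
    shuffle x y (inv\<^bsub>\<Gamma>\<^esub> p) = inv\<^bsub>BijGroup space\<^esub> shuffle x y p)"
proof -
  interpret B: group "BijGroup space" by (rule group_BijGroup)
  obtain S where S: "finite S" "S \<subseteq> X" "\<And>x y. spread S x y \<Longrightarrow>
    shuffle x y (inv\<^bsub>\<Gamma>\<^esub> p \<otimes>\<^bsub>\<Gamma>\<^esub> p) = shuffle x y (inv\<^bsub>\<Gamma>\<^esub> p) \<otimes>\<^bsub>BijGroup space\<^esub> shuffle x y p"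
    using shuffle_mult_spread[of "inv\<^bsub>\<Gamma>\<^esub> p" p] assms by auto
  have "shuffle x y (inv\<^bsub>\<Gamma>\<^esub> p) = inv\<^bsub>BijGroup space\<^esub> shuffle x y p" if "spread S x y" for x y
  proof -
    have "x \<in> X" "y \<in> X" using that by (auto simp: spread_def)
    then show ?thesis
      using S(3)[OF that] assms by (intro B.inv_equality[symmetric]) (auto simp: shuffle_one shuffle_closed)
  qed
  with S(1,2) show ?thesis by blast
qed

lemma shuffle_letter_val_spread:
  assumes "\<gamma> \<in> I \<rightarrow> carrier \<Gamma>" "l \<in> I \<times> UNIV"
  shows "\<exists>S. finite S \<and> S \<subseteq> X \<and> (\<forall>x y. spread S x y \<longrightarrow>
    shuffle x y (letter_val \<Gamma> \<gamma> l) = letter_val (BijGroup space) (shuffle x y \<circ> \<gamma>) l)"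
proof (cases "snd l")
  case False
  have "\<gamma> (fst l) \<in> carrier \<Gamma>" using assms by auto
  from shuffle_inv_spread[OF this] False show ?thesis by (simp add: letter_val_def)
qed (auto simp: letter_val_def)

text \<open>Evaluating a word takes finitely many products and inverses of fixed elements of
  \<open>\<Gamma>\<close>; the union of their exceptional sets serves the whole word.\<close>

lemma shuffle_word_val_spread:
  assumes "\<gamma> \<in> I \<rightarrow> carrier \<Gamma>" "set w \<subseteq> I \<times> UNIV"
  shows "\<exists>S. finite S \<and> S \<subseteq> X \<and> (\<forall>x y. spread S x y \<longrightarrow>
    shuffle x y (word_val \<Gamma> \<gamma> w) = word_val (BijGroup space) (shuffle x y \<circ> \<gamma>) w)"
  using assms(2)
proof (induction w)
  case Nil
  have "finite {} \<and> {} \<subseteq> X \<and> (\<forall>x y. spread {} x y \<longrightarrow>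
    shuffle x y (word_val \<Gamma> \<gamma> []) = word_val (BijGroup space) (shuffle x y \<circ> \<gamma>) [])"
    by (simp add: spread_def shuffle_one)
  then show ?case by blast
next
  case (Cons l w)
  then have l: "l \<in> I \<times> UNIV" and w: "set w \<subseteq> I \<times> UNIV" by auto
  obtain S1 where S1: "finite S1" "S1 \<subseteq> X" "\<And>x y. spread S1 x y \<Longrightarrow>
    shuffle x y (word_val \<Gamma> \<gamma> w) = word_val (BijGroup space) (shuffle x y \<circ> \<gamma>) w"
    using Cons.IH[OF w] by blast
  obtain S2 where S2: "finite S2" "S2 \<subseteq> X" "\<And>x y. spread S2 x y \<Longrightarrow>
    shuffle x y (letter_val \<Gamma> \<gamma> l) = letter_val (BijGroup space) (shuffle x y \<circ> \<gamma>) l"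
    using shuffle_letter_val_spread[OF assms(1) l] by blast
  obtain S3 where S3: "finite S3" "S3 \<subseteq> X" "\<And>x y. spread S3 x y \<Longrightarrow>
    shuffle x y (letter_val \<Gamma> \<gamma> l \<otimes>\<^bsub>\<Gamma>\<^esub> word_val \<Gamma> \<gamma> w) =
    shuffle x y (letter_val \<Gamma> \<gamma> l) \<otimes>\<^bsub>BijGroup space\<^esub> shuffle x y (word_val \<Gamma> \<gamma> w)"
    using shuffle_mult_spread[OF \<Gamma>.letter_val_closed[OF assms(1) l] \<Gamma>.word_val_closed[OF assms(1) w]]
    by blast
  show ?case
  proof (intro exI[of _ "S1 \<union> S2 \<union> S3"] conjI allI impI)
    fix x y assume "spread (S1 \<union> S2 \<union> S3) x y"
    then have "spread S1 x y" "spread S2 x y" "spread S3 x y"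
      by (auto intro: spread_mono)
    then show "shuffle x y (word_val \<Gamma> \<gamma> (l # w)) = word_val (BijGroup space) (shuffle x y \<circ> \<gamma>) (l # w)"
      by (simp add: S1 S2 S3)
  qed (use S1 S2 S3 in auto)
qed

text \<open>As \<open>x\<close> and \<open>y\<close> differ, no translate carries both to
  \<open>u\<close>, so \<open>triv\<close> holds at every \<open>k\<close>.\<close>

lemma shuffle_mult_base_base:
  assumes "x \<in> X" "y \<in> X" "x \<noteq> y" "u \<in> X" "v \<in> carrier W" "w \<in> carrier W"
  shows "shuffle x y (base u (v \<otimes>\<^bsub>W\<^esub> w)) =
    shuffle x y (base u v) \<otimes>\<^bsub>BijGroup space\<^esub> shuffle x y (base u w)"
proof -
  have "\<phi> k x \<noteq> \<phi> k y" if "k \<in> carrier M" for k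
    using act.inj_prop[OF that] assms by (auto dest: inj_onD)
  then show ?thesis
    using assms unfolding base_mult[OF assms(5,6)]
    by (intro shuffle_mult) auto
qed

lemma shuffle_mult_top:
  assumes "x \<in> X" "y \<in> X" "g \<in> carrier M" "p \<in> carrier \<Gamma>"
  shows "shuffle x y (top g \<otimes>\<^bsub>\<Gamma>\<^esub> p) = shuffle x y (top g) \<otimes>\<^bsub>BijGroup space\<^esub> shuffle x y p"
    "snd p = \<one>\<^bsub>M\<^esub> \<Longrightarrow>
      shuffle x y (p \<otimes>\<^bsub>\<Gamma>\<^esub> top g) = shuffle x y p \<otimes>\<^bsub>BijGroup space\<^esub> shuffle x y (top g)"
  using assms by (auto intro!: shuffle_mult)

text \<open>Shuffling is multiplicative on tops, on a top times an element of the base, and on two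
  base elements at the same coordinate. These products suffice to build every
  \<open>base u w\<close> from the tops and coordinates of the generating letters, so agreement with
  \<open>s\<close> spreads from there.\<close>

lemma shuffle_hom_agrees:
  assumes xy: "x \<in> X" "y \<in> X" "x \<noteq> y"
    and s: "s \<in> hom \<Gamma> (BijGroup space)"
    and \<gamma>: "\<gamma> \<in> I \<rightarrow> carrier \<Gamma>"
    and gen: "\<And>g. g \<in> carrier \<Gamma> \<Longrightarrow> \<exists>w. set w \<subseteq> I \<times> UNIV \<and> word_val \<Gamma> \<gamma> w = g"
    and agree_top: "\<And>l. l \<in> I \<times> UNIV \<Longrightarrow>
      s (top (snd (letter_val \<Gamma> \<gamma> l))) = shuffle x y (top (snd (letter_val \<Gamma> \<gamma> l)))"
    and agree_base: "\<And>l u. \<lbrakk>l \<in> I \<times> UNIV; u \<in> X\<rbrakk> \<Longrightarrow>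
      s (base u (fst (letter_val \<Gamma> \<gamma> l) u)) = shuffle x y (base u (fst (letter_val \<Gamma> \<gamma> l) u))"
    and uw: "u \<in> X" "w \<in> carrier W"
  shows "s (base u w) = shuffle x y (base u w)"
proof -
  interpret B: group "BijGroup space" by (rule group_BijGroup)
  interpret s: group_hom \<Gamma> "BijGroup space" s
    using s by unfold_locales
  have one: "base u \<one>\<^bsub>W\<^esub> = \<one>\<^bsub>\<Gamma>\<^esub>" "top \<one>\<^bsub>M\<^esub> = \<one>\<^bsub>\<Gamma>\<^esub>" for u
    by (auto simp: base_def top_def one_wreath)
  have top: "s (top g) = shuffle x y (top g)" if g: "g \<in> carrier M" for g
  proof -
    have "s (top (snd (word_val \<Gamma> \<gamma> w))) = shuffle x y (top (snd (word_val \<Gamma> \<gamma> w)))"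
      if "set w \<subseteq> I \<times> UNIV" for w
      using that
    proof (induction w)
      case Nil
      then show ?case using xy by (simp add: one shuffle_one) 
    next
      case (Cons l w)
      let ?a = "letter_val \<Gamma> \<gamma> l" and ?b = "word_val \<Gamma> \<gamma> w"
      have ab: "?a \<in> carrier \<Gamma>" "?b \<in> carrier \<Gamma>"
        using Cons.prems by (auto intro!: \<Gamma>.letter_val_closed[OF \<gamma>] \<Gamma>.word_val_closed[OF \<gamma>])
      have "snd (?a \<otimes>\<^bsub>\<Gamma>\<^esub> ?b) = snd ?a \<otimes>\<^bsub>M\<^esub> snd ?b"
        by (cases ?a, cases ?b) (simp add: mult_wreath)
      then show ?case
        using Cons agree_top[of l] ab xy by (simp add: top_mult snd_closed shuffle_mult_top)
    qed
    moreover obtain w where "set w \<subseteq> I \<times> UNIV" "word_val \<Gamma> \<gamma> w = top g"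
      using gen[of "top g"] g by auto
    ultimately show ?thesis by (metis fst_snd_simps(4))
  qed
  \<comment> \<open>Conjugation by \<open>top g\<close> carries coordinate \<open>u\<close> to
    \<open>g u\<close>, and both \<open>s\<close> and the shuffle respect this relation.\<close>
  have move: "s (base (\<phi> g u) w) = shuffle x y (base (\<phi> g u) w)"
    if eq: "s (base u w) = shuffle x y (base u w)"
      and guw: "g \<in> carrier M" "u \<in> X" "w \<in> carrier W" for g u w
  proof -
    have sh: "shuffle x y p \<in> carrier (BijGroup space)" if "p \<in> carrier \<Gamma>" for p
      using shuffle_closed[OF xy(1,2) that] .
    have "s (base (\<phi> g u) w) \<otimes>\<^bsub>BijGroup space\<^esub> s (top g) = s (top g) \<otimes>\<^bsub>BijGroup space\<^esub> s (base u w)"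
      using guw base_conj[OF guw] by (simp flip: s.hom_mult)
    also have "\<dots> = shuffle x y (top g \<otimes>\<^bsub>\<Gamma>\<^esub> base u w)"
      using guw xy by (simp add: shuffle_mult_top top eq)
    also have "\<dots> = shuffle x y (base (\<phi> g u) w) \<otimes>\<^bsub>BijGroup space\<^esub> s (top g)"
      using guw xy unfolding base_conj[OF guw]
      by (subst shuffle_mult_top(2)) (auto simp: top)
    finally show ?thesis using guw sh by simp
  qed
  \<comment> \<open>Coordinate \<open>u\<close> of a letter times a word is the product of
    coordinate \<open>u\<close> of the letter and coordinate \<open>g\<inverse> u\<close> of the
    word, where \<open>g\<close> is the top of the letter. The induction therefore has to range over
    all \<open>u\<close>.\<close>
  have word: "s (base u (fst (word_val \<Gamma> \<gamma> w) u)) = shuffle x y (base u (fst (word_val \<Gamma> \<gamma> w) u))"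
    if "set w \<subseteq> I \<times> UNIV" "u \<in> X" for u w
    using that
  proof (induction w arbitrary: u)
    case Nil
    then show ?case using xy by (simp add: one shuffle_one)
  next
    case (Cons l w)
    let ?a = "letter_val \<Gamma> \<gamma> l" and ?b = "word_val \<Gamma> \<gamma> w"
    have ab: "?a \<in> carrier \<Gamma>" "?b \<in> carrier \<Gamma>"
      using Cons.prems by (auto intro!: \<Gamma>.letter_val_closed[OF \<gamma>] \<Gamma>.word_val_closed[OF \<gamma>])
    let ?g = "snd ?a"
    let ?v = "\<phi> (inv\<^bsub>M\<^esub> ?g) u"
    have g: "?g \<in> carrier M" "?v \<in> X" "\<phi> ?g ?v = u" using ab Cons.prems by (simp_all add: snd_closed)
    have "fst (?a \<otimes>\<^bsub>\<Gamma>\<^esub> ?b) u = fst ?a u \<otimes>\<^bsub>W\<^esub> fst ?b ?v"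
      using Cons.prems by (cases ?a, cases ?b) (simp add: mult_wreath)
    moreover have "s (base ?v (fst ?b ?v)) = shuffle x y (base ?v (fst ?b ?v))"
      using Cons g by simp
    then have "s (base u (fst ?b ?v)) = shuffle x y (base u (fst ?b ?v))"
      using move[OF _ g(1,2) fst_closed[OF ab(2) g(2)]] g(3) by simp
    moreover have "s (base u (fst ?a u)) = shuffle x y (base u (fst ?a u))"
      using Cons.prems agree_base by simp
    ultimately show ?case
      using Cons.prems xy ab g
      by (simp add: shuffle_mult_base_base fst_closed) (simp add: base_mult fst_closed)
  qed
  obtain t where t: "set t \<subseteq> I \<times> UNIV" "word_val \<Gamma> \<gamma> t = base u w"
    using gen[of "base u w"] uw by auto
  show ?thesis using word[OF t(1) uw(1)] uw by (simp add: t(2))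
qed

lemma finitely_presented_imp_cofinite_on_pairs:
  assumes fp: "finitely_presented \<Gamma>" and ne: "carrier W \<noteq> {\<one>\<^bsub>W\<^esub>}"
  shows "\<exists>S. finite S \<and> S \<subseteq> X \<and>
    (\<forall>x\<in>X. \<forall>y\<in>X. x \<noteq> y \<longrightarrow> (\<exists>k\<in>carrier M. \<phi> k x \<in> S \<and> \<phi> k y \<in> S))"
proof -
  obtain n :: nat and \<gamma> R where \<gamma>: "\<gamma> \<in> {..<n} \<rightarrow> carrier \<Gamma>" and R: "finite R"
    "\<And>r. r \<in> R \<Longrightarrow> set r \<subseteq> {..<n} \<times> UNIV \<and> word_val \<Gamma> \<gamma> r = \<one>\<^bsub>\<Gamma>\<^esub>"
    and gen: "\<And>g. g \<in> carrier \<Gamma> \<Longrightarrow> \<exists>w. set w \<subseteq> {..<n} \<times> UNIV \<and> word_val \<Gamma> \<gamma> w = g"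
    and univ: "\<And>(H :: ('g \<times> 'w option \<Rightarrow> 'g \<times> 'w option) monoid) \<delta>. \<lbrakk>group H; \<delta> \<in> {..<n} \<rightarrow> carrier H;
        \<forall>r\<in>R. word_val H \<delta> r = \<one>\<^bsub>H\<^esub>\<rbrakk> \<Longrightarrow> \<exists>s\<in>hom \<Gamma> H. \<forall>i<n. s (\<gamma> i) = \<delta> i"
    by (rule finitely_presentedE[OF \<Gamma>.is_group fp,
        where 'h = "'g \<times> 'w option \<Rightarrow> 'g \<times> 'w option"]) (rule that)
  interpret B: group "BijGroup space" by (rule group_BijGroup)
  have "\<exists>wd. \<forall>g\<in>carrier \<Gamma>. set (wd g) \<subseteq> {..<n} \<times> UNIV \<and> word_val \<Gamma> \<gamma> (wd g) = g"
    using gen by metis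
  then obtain wd where wd: "\<And>g. g \<in> carrier \<Gamma> \<Longrightarrow> set (wd g) \<subseteq> {..<n} \<times> UNIV"
    "\<And>g. g \<in> carrier \<Gamma> \<Longrightarrow> word_val \<Gamma> \<gamma> (wd g) = g" by blast
  \<comment> \<open>\<open>L\<close> holds the generators and their inverses. \<open>D\<close>
    collects their tops and nontrivial coordinates, the elements on which
    \<open>shuffle_hom_agrees\<close> asks for agreement; it is finite because supports are.\<close>
  define L where "L = letter_val \<Gamma> \<gamma> ` ({..<n} \<times> UNIV)"
  define D where "D = (\<Union>p\<in>L. {top (snd p), \<one>\<^bsub>\<Gamma>\<^esub>} \<union> (\<lambda>u. base u (fst p u)) ` {u \<in> X. fst p u \<noteq> \<one>\<^bsub>W\<^esub>})"
  have L: "L \<subseteq> carrier \<Gamma>" using \<Gamma>.letter_val_closed[OF \<gamma>] by (auto simp: L_def)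
  have "finite D"
    unfolding D_def
  proof (rule finite_UN_I)
    fix p assume "p \<in> L"
    then have "finite {u \<in> X. fst p u \<noteq> \<one>\<^bsub>W\<^esub>}"
      using L by (cases p) (auto simp: carrier_wreath)
    then show "finite ({top (snd p), \<one>\<^bsub>\<Gamma>\<^esub>} \<union> (\<lambda>u. base u (fst p u)) ` {u \<in> X. fst p u \<noteq> \<one>\<^bsub>W\<^esub>})"
      by simp
  qed (simp add: L_def)
  have D: "D \<subseteq> carrier \<Gamma>"
  proof
    fix d assume "d \<in> D"
    then obtain p where "p \<in> carrier \<Gamma>"
      "d \<in> {top (snd p), \<one>\<^bsub>\<Gamma>\<^esub>} \<union> (\<lambda>u. base u (fst p u)) ` {u \<in> X. fst p u \<noteq> \<one>\<^bsub>W\<^esub>}"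
      using L unfolding D_def by blast
    then show "d \<in> carrier \<Gamma>"
      using snd_closed[of p] fst_closed[of p] top_closed base_closed by blast
  qed
  \<comment> \<open>Two kinds of words must be respected: the relators, so that the shuffled
    generators define a homomorphism \<open>s\<close>, and words for the elements of
    \<open>D\<close>, so that \<open>s\<close> agrees with the shuffle on \<open>D\<close>.\<close>
  have "\<forall>w\<in>R \<union> wd ` D. \<exists>S. finite S \<and> S \<subseteq> X \<and> (\<forall>x y. spread S x y \<longrightarrow>
    shuffle x y (word_val \<Gamma> \<gamma> w) = word_val (BijGroup space) (shuffle x y \<circ> \<gamma>) w)"
    using R(2) wd(1) D by (intro ballI shuffle_word_val_spread[OF \<gamma>]) blast
  then obtain S where S: "\<And>w. w \<in> R \<union> wd ` D \<Longrightarrow> finite (S w)" "\<And>w. w \<in> R \<union> wd ` D \<Longrightarrow> S w \<subseteq> X"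
    "\<And>w x y. \<lbrakk>w \<in> R \<union> wd ` D; spread (S w) x y\<rbrakk> \<Longrightarrow>
      shuffle x y (word_val \<Gamma> \<gamma> w) = word_val (BijGroup space) (shuffle x y \<circ> \<gamma>) w"
    by metis
  let ?S = "\<Union>w\<in>R \<union> wd ` D. S w"
  show ?thesis
  proof (intro exI[of _ ?S] conjI ballI impI)
    show "finite ?S" using R(1) \<open>finite D\<close> S(1) by blast
    show "?S \<subseteq> X" using S(2) by blast
    fix x y assume xy: "x \<in> X" "y \<in> X" "x \<noteq> y"
    show "\<exists>k\<in>carrier M. \<phi> k x \<in> ?S \<and> \<phi> k y \<in> ?S"
    proof (rule ccontr)
      assume "\<not> ?thesis"
      then have "spread ?S x y" using xy by (auto simp: spread_def)
      then have eq: "shuffle x y (word_val \<Gamma> \<gamma> w) = word_val (BijGroup space) (shuffle x y \<circ> \<gamma>) w"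
        if "w \<in> R \<union> wd ` D" for w
        using that by (intro S(3)) (auto intro: spread_mono)
      have sh: "shuffle x y p \<in> carrier (BijGroup space)" if "p \<in> carrier \<Gamma>" for p
        using shuffle_closed[OF xy(1,2) that] .
      have "shuffle x y \<circ> \<gamma> \<in> {..<n} \<rightarrow> carrier (BijGroup space)"
        using \<gamma> sh unfolding Pi_iff comp_def by blast
      moreover have "word_val (BijGroup space) (shuffle x y \<circ> \<gamma>) r = \<one>\<^bsub>BijGroup space\<^esub>" if "r \<in> R" for r
        using eq[of r] R(2)[OF that] that xy by (simp add: shuffle_one)
      ultimately obtain s where s: "s \<in> hom \<Gamma> (BijGroup space)" "\<And>i. i < n \<Longrightarrow> s (\<gamma> i) = shuffle x y (\<gamma> i)"
        using univ[OF B.is_group, of "shuffle x y \<circ> \<gamma>"] by auto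
      interpret s: group_hom \<Gamma> "BijGroup space" s
        using s(1) by unfold_locales
      have sD: "s d = shuffle x y d" if "d \<in> D" for d
      proof -
        have d: "d \<in> carrier \<Gamma>" using that D by blast
        have "s d = word_val (BijGroup space) (s \<circ> \<gamma>) (wd d)"
          using hom_word_val[OF \<Gamma>.is_group B.is_group s(1) \<gamma> wd(1)[OF d]] wd(2)[OF d] by simp
        also have "\<dots> = word_val (BijGroup space) (shuffle x y \<circ> \<gamma>) (wd d)"
          using s(2) wd(1)[OF d] by (intro word_val_cong[of "{..<n}"]) auto
        also have "\<dots> = shuffle x y d"
          using eq[of "wd d"] that wd(2)[OF d] by simp
        finally show ?thesis .
      qed
      have s_base: "s (base u w) = shuffle x y (base u w)" if "u \<in> X" "w \<in> carrier W" for u w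
      proof (rule shuffle_hom_agrees[OF xy s(1) \<gamma> gen _ _ that])
        fix l :: "nat \<times> bool" assume l: "l \<in> {..<n} \<times> UNIV"
        let ?p = "letter_val \<Gamma> \<gamma> l"
        have p: "?p \<in> L" using l by (auto simp: L_def)
        then show "s (top (snd ?p)) = shuffle x y (top (snd ?p))"
          by (intro sD) (auto simp: D_def)
        fix u assume u: "u \<in> X"
        have "base u (fst ?p u) = \<one>\<^bsub>\<Gamma>\<^esub>" if "fst ?p u = \<one>\<^bsub>W\<^esub>"
          using that by (auto simp: base_def one_wreath)
        moreover have "base u (fst ?p u) \<in> D" if "fst ?p u \<noteq> \<one>\<^bsub>W\<^esub>"
          using that p u unfolding D_def by blast
        ultimately show "s (base u (fst ?p u)) = shuffle x y (base u (fst ?p u))"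
          using xy sD by (cases "fst ?p u = \<one>\<^bsub>W\<^esub>") (simp_all add: shuffle_one)
      qed
      obtain w where w: "w \<in> carrier W" "w \<noteq> \<one>\<^bsub>W\<^esub>" using ne W.one_closed by blast
      \<comment> \<open>Elements at the distinct coordinates \<open>x\<close> and \<open>y\<close>
        commute in \<open>\<Gamma>\<close>, hence so do their images under \<open>s\<close>. On the
        copy indexed by the identity these images are the two non-commuting actions of
        \<open>w\<close>.\<close>
      have "shuffle x y (base x w) \<otimes>\<^bsub>BijGroup space\<^esub> shuffle x y (base y w) =
          shuffle x y (base y w) \<otimes>\<^bsub>BijGroup space\<^esub> shuffle x y (base x w)"
        using w xy base_commute[OF xy(3) w(1) w(1)]
        by (simp flip: s_base s.hom_mult)
      then have "compose space (shuffle x y (base x w)) (shuffle x y (base y w)) (\<one>\<^bsub>M\<^esub>, Some \<one>\<^bsub>W\<^esub>) =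
          compose space (shuffle x y (base y w)) (shuffle x y (base x w)) (\<one>\<^bsub>M\<^esub>, Some \<one>\<^bsub>W\<^esub>)"
        using sh[of "base x w"] sh[of "base y w"] w by (simp add: BijGroup_def)
      moreover have one: "Some \<one>\<^bsub>W\<^esub> \<in> pts" by (simp add: pts_def)
      have "shuffle x y (base x w) (\<one>\<^bsub>M\<^esub>, z) = (\<one>\<^bsub>M\<^esub>, left_act w z)"
        "shuffle x y (base y w) (\<one>\<^bsub>M\<^esub>, z) = (\<one>\<^bsub>M\<^esub>, left_act' w z)" if "z \<in> pts" for z
        using that xy w by (auto simp: shuffle_def space_def Let_def)
      ultimately show False
        using left_acts_do_not_commute[OF w] w by (simp add: compose_def space_def one)
    qed
  qed
qed

end

section \<open>Automorphisms of rooted trees\<close>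

lemma tree_verts_take: "v \<in> tree_verts A \<Longrightarrow> take k v \<in> tree_verts A"
  by (simp add: tree_verts_def)

lemma tree_level_take: "\<lbrakk>v \<in> tree_level A n; k \<le> n\<rbrakk> \<Longrightarrow> take k v \<in> tree_level A k"
  by (auto simp: tree_level_def tree_verts_take)

context
  fixes A :: "nat \<Rightarrow> 'a set" and g
  assumes g: "g \<in> carrier (tree_aut A)"
begin

lemma tree_aut_bij: "bij_betw g (tree_verts A) (tree_verts A)"
  using g by (simp add: tree_aut_def Bij_def)

lemma tree_aut_closed: "v \<in> tree_verts A \<Longrightarrow> g v \<in> tree_verts A"
  using tree_aut_bij by (auto simp: bij_betw_def)

lemma tree_aut_eq_iff: "\<lbrakk>v \<in> tree_verts A; w \<in> tree_verts A\<rbrakk> \<Longrightarrow> g v = g w \<longleftrightarrow> v = w"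
  using tree_aut_bij by (auto simp: bij_betw_def inj_on_eq_iff)

text \<open>The image of a child of \<open>v\<close> is adjacent to \<open>g v\<close>. It is not
  the parent of \<open>g v\<close>, because by induction that is the image of the parent of
  \<open>v\<close> and \<open>g\<close> is injective; so it is a child.\<close>

lemma tree_aut_child:
  "v @ [a] \<in> tree_verts A \<Longrightarrow> \<exists>b. g (v @ [a]) = g v @ [b]"
proof (induction v arbitrary: a rule: rev_induct)
  case Nil
  have "[] \<in> tree_verts A" by (simp add: tree_verts_def)
  then have "tree_adj (g [a]) (g [])" "g [] = []"
    using g Nil by (auto simp: tree_aut_def tree_adj_def)
  then show ?case by (auto simp: tree_adj_def length_Suc_conv)
next
  case (snoc c v)
  have V: "v @ [c] \<in> tree_verts A" "v \<in> tree_verts A"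
    using tree_verts_take[OF snoc.prems, of "Suc (length v)"]
      tree_verts_take[OF snoc.prems, of "length v"] by simp_all
  then obtain b where b: "g (v @ [c]) = g v @ [b]" using snoc.IH by blast
  have "tree_adj ((v @ [c]) @ [a]) (v @ [c])" by (simp add: tree_adj_def)
  then have "tree_adj (g ((v @ [c]) @ [a])) (g (v @ [c]))"
    using g V(1) snoc.prems by (simp add: tree_aut_def)
  moreover have "g ((v @ [c]) @ [a]) \<noteq> g v"
    using V snoc.prems by (simp add: tree_aut_eq_iff)
  moreover have "h = x" if "prefix h (x @ [b])" "length (x @ [b]) = length h + 1" for h x :: "'a list"
    using that by (auto simp: prefix_snoc) (metis append_eq_conv_conj prefixE take_all_iff order_refl)
  moreover have "\<exists>d. h = x @ [d]" if "prefix x h" "length h = length x + 1" for h x :: "'a list"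
  proof -
    obtain zs where "h = x @ zs" using \<open>prefix x h\<close> by (auto simp: prefix_def)
    then show ?thesis using \<open>length h = length x + 1\<close> by (cases zs) auto
  qed
  ultimately show ?case
    unfolding tree_adj_def b by metis
qed

lemma tree_aut_length: "v \<in> tree_verts A \<Longrightarrow> length (g v) = length v"
proof (induction v rule: rev_induct)
  case Nil
  then show ?case using g by (simp add: tree_aut_def)
next
  case (snoc a v)
  then show ?case using tree_aut_child[of v a] tree_verts_take[of "v @ [a]" A "length v"] by auto
qed

lemma tree_aut_take: "v \<in> tree_verts A \<Longrightarrow> g (take k v) = take k (g v)"
proof (induction v rule: rev_induct)
  case Nil
  then show ?case using g by (simp add: tree_aut_def)
next
  case (snoc a v)
  have v: "v \<in> tree_verts A" using tree_verts_take[OF snoc.prems, of "length v"] by simp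
  obtain b where "g (v @ [a]) = g v @ [b]" using tree_aut_child[OF snoc.prems] by blast
  then show ?case
    using snoc.IH[OF v] tree_aut_length[OF v] by (cases "k \<le> length v") auto
qed

lemma tree_aut_level: "v \<in> tree_level A n \<Longrightarrow> g v \<in> tree_level A n"
  by (simp add: tree_level_def tree_aut_closed tree_aut_length)

lemma tree_aut_prefix_iff:
  assumes "v \<in> tree_verts A" "w \<in> tree_verts A"
  shows "prefix (g v) (g w) \<longleftrightarrow> prefix v w"
proof -
  have pr: "prefix u u' \<longleftrightarrow> take (length u) u' = u" for u u' :: "'a list"
    by (auto simp: prefix_def) (metis append_take_drop_id)
  show ?thesis
    using assms by (simp add: pr tree_aut_length tree_aut_eq_iff tree_verts_take flip: tree_aut_take)
qed

end

lemma tree_aut_mult: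
  assumes "g \<in> carrier (tree_aut A)" "h \<in> carrier (tree_aut A)" "v \<in> tree_verts A"
  shows "(g \<otimes>\<^bsub>tree_aut A\<^esub> h) v = g (h v)"
  using assms by (simp add: tree_aut_def BijGroup_def compose_eq)

lemma tree_aut_one: "v \<in> tree_verts A \<Longrightarrow> \<one>\<^bsub>tree_aut A\<^esub> v = v"
  by (simp add: tree_aut_def BijGroup_def)

lemma tree_aut_eqI:
  assumes "g \<in> carrier (tree_aut A)" "h \<in> carrier (tree_aut A)"
    and "\<And>v. v \<in> tree_verts A \<Longrightarrow> g v = h v"
  shows "g = h"
  using assms by (intro extensionalityI[of _ "tree_verts A"]) (auto simp: tree_aut_def Bij_def)

lemma finite_tree_level:
  assumes "\<And>i. finite (A i)"
  shows "finite (tree_level A n)"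
proof (rule finite_subset)
  show "tree_level A n \<subseteq> {v. set v \<subseteq> (\<Union>i<n. A i) \<and> length v = n}"
    by (fastforce simp: tree_level_def tree_verts_def in_set_conv_nth)
  show "finite {v. set v \<subseteq> (\<Union>i<n. A i) \<and> length v = n}"
    using assms by (intro finite_lists_length_eq) auto
qed

lemma tree_level_branch:
  assumes "v \<in> tree_level A n" "d < n" "card (A d) \<ge> 2"
  obtains w where "w \<in> tree_level A n" "take d w = take d v" "take (Suc d) w \<noteq> take (Suc d) v"
proof -
  have "\<not> A d \<subseteq> {v ! d}"
    using assms(3) card_mono[of "{v ! d}" "A d"] by fastforce
  then obtain a where a: "a \<in> A d" "a \<noteq> v ! d" by blast
  show ?thesis
  proof (rule that[of "v[d := a]"])
    show "v[d := a] \<in> tree_level A n"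
      using assms a by (auto simp: tree_level_def tree_verts_def nth_list_update)
    show "take (Suc d) (v[d := a]) \<noteq> take (Suc d) v"
      using assms a by (auto simp: tree_level_def take_Suc_conv_app_nth)
  qed simp
qed

section \<open>Actions of branch groups with finitely many orbits of pairs\<close>

text \<open>The set \<open>S\<close> comes from the wreath product argument:
  \<open>S \<times> S\<close> meets every orbit of pairs, which expresses that there are finitely
  many.\<close>

locale branch_action = act: group_action "(tree_aut A)\<lparr>carrier := G\<rparr>" X \<phi>
  for A :: "nat \<Rightarrow> 'a set" and G and X :: "'x set" and \<phi> +
  fixes S :: "'x set"
  assumes alphabet: "\<And>i. finite (A i)" "\<And>i. card (A i) \<ge> 2"
    and branch: "branch_group A G"
    and finite_S: "finite S" and S_sub: "S \<subseteq> X"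
    and pairs: "\<And>x y. \<lbrakk>x \<in> X; y \<in> X\<rbrakk> \<Longrightarrow> \<exists>k\<in>G. \<phi> k x \<in> S \<and> \<phi> k y \<in> S"
begin

abbreviation V where "V \<equiv> tree_verts A"
abbreviation L where "L \<equiv> tree_level A"
abbreviation K where "K \<equiv> rist A G"
abbreviation mult (infixl "\<odot>" 70) where "g \<odot> h \<equiv> g \<otimes>\<^bsub>tree_aut A\<^esub> h"
abbreviation inverse ("\<iota>") where "\<iota> g \<equiv> inv\<^bsub>tree_aut A\<^esub> g"

sublocale T: group "tree_aut A" by (rule group_tree_aut)

lemma subgroup_G: "subgroup G (tree_aut A)"
  using branch by (simp add: branch_group_def)

lemma G_aut: "g \<in> G \<Longrightarrow> g \<in> carrier (tree_aut A)"
  using subgroup_G by (rule subgroup.mem_carrier)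

lemma G_closed [simp]:
  "\<lbrakk>g \<in> G; h \<in> G\<rbrakk> \<Longrightarrow> g \<odot> h \<in> G" "g \<in> G \<Longrightarrow> \<iota> g \<in> G" "\<one>\<^bsub>tree_aut A\<^esub> \<in> G"
  using subgroup_G by (auto simp: subgroup_def)

lemma act_closed [simp]: "\<lbrakk>g \<in> G; x \<in> X\<rbrakk> \<Longrightarrow> \<phi> g x \<in> X"
  using act.element_image[of g x] by simp

lemma act_mult: "\<lbrakk>g \<in> G; h \<in> G; x \<in> X\<rbrakk> \<Longrightarrow> \<phi> (g \<odot> h) x = \<phi> g (\<phi> h x)"
  using act.composition_rule[of x g h] by simp

lemma act_one [simp]: "x \<in> X \<Longrightarrow> \<phi> \<one>\<^bsub>tree_aut A\<^esub> x = x"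
  using fun_cong[OF act.id_eq_one, of x] by simp

lemma act_inv [simp]:
  assumes "g \<in> G" "x \<in> X"
  shows "\<phi> g (\<phi> (\<iota> g) x) = x" "\<phi> (\<iota> g) (\<phi> g x) = x"
  using assms G_aut[of g] by (simp_all flip: act_mult)

lemma act_eq_iff: "\<lbrakk>g \<in> G; x \<in> X; y \<in> X\<rbrakk> \<Longrightarrow> \<phi> g x = \<phi> g y \<longleftrightarrow> x = y"
  by (metis act_inv(2))

lemma vert_mult: "\<lbrakk>g \<in> G; h \<in> G; v \<in> V\<rbrakk> \<Longrightarrow> (g \<odot> h) v = g (h v)"
  by (simp add: tree_aut_mult G_aut)

lemma vert_inv [simp]:
  assumes "g \<in> G" "v \<in> V"
  shows "g ((\<iota> g) v) = v" "(\<iota> g) (g v) = v"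
  using assms G_aut[of g] tree_aut_one[of v A] by (simp_all flip: vert_mult)

lemma vert_closed [simp]: "\<lbrakk>g \<in> G; v \<in> V\<rbrakk> \<Longrightarrow> g v \<in> V"
  using tree_aut_closed[OF G_aut] .

lemma level_closed [simp]: "\<lbrakk>g \<in> G; v \<in> L n\<rbrakk> \<Longrightarrow> g v \<in> L n"
  using tree_aut_level[OF G_aut] .

lemma level_vert: "v \<in> L n \<Longrightarrow> v \<in> V" "v \<in> L n \<Longrightarrow> length v = n"
  by (simp_all add: tree_level_def)

lemma level_transitive: "\<lbrakk>v \<in> L n; w \<in> L n\<rbrakk> \<Longrightarrow> \<exists>g\<in>G. g v = w"
  using branch by (simp add: branch_group_def)

lemma rist_G: "a \<in> K v \<Longrightarrow> a \<in> G"
  by (simp add: rist_def)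

lemma rist_mult: "\<lbrakk>a \<in> K v; b \<in> K v\<rbrakk> \<Longrightarrow> a \<odot> b \<in> K v"
  by (auto simp: rist_def vert_mult)

lemma rist_inv:
  assumes "a \<in> K v"
  shows "\<iota> a \<in> K v"
  unfolding rist_def
proof (intro CollectI conjI ballI)
  have a: "a \<in> G" using assms by (rule rist_G)
  then show "\<iota> a \<in> G" by simp
  fix w assume w: "w \<in> V - subtree A v"
  then have "a w = w" using assms by (simp add: rist_def)
  then show "(\<iota> a) w = w" using vert_inv(2)[OF a, of w] w by simp
qed

lemma rist_mono: "prefix u v \<Longrightarrow> K v \<subseteq> K u"
  by (auto simp: rist_def subtree_def)

lemma rist_take: "K v \<subseteq> K (take k v)"
  by (rule rist_mono) (simp add: take_is_prefix)

lemma rist_subtree: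
  assumes "a \<in> K u" "w \<in> subtree A u"
  shows "a w \<in> subtree A u"
proof (rule ccontr)
  assume "a w \<notin> subtree A u"
  moreover have w: "w \<in> V" "a w \<in> V" using assms rist_G by (auto simp: subtree_def)
  ultimately have "a (a w) = a w" using assms by (auto simp: rist_def)
  then have "a w = w"
    using w tree_aut_eq_iff[OF G_aut[OF rist_G[OF assms(1)]], of "a w" w] by simp
  then show False using assms \<open>a w \<notin> _\<close> by simp
qed

section \<open>Commutation and conjugation of rigid stabilizers\<close>

definition incomp :: "'a list \<Rightarrow> 'a list \<Rightarrow> bool" where
  "incomp u v \<longleftrightarrow> u \<in> V \<and> v \<in> V \<and> u \<parallel> v"

lemma incomp_sym: "incomp u v \<Longrightarrow> incomp v u"
  by (auto simp: incomp_def)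

lemma incomp_level: "\<lbrakk>u \<in> L n; v \<in> L n; u \<noteq> v\<rbrakk> \<Longrightarrow> incomp u v"
  by (simp add: incomp_def tree_level_def not_equal_is_parallel)

lemma incomp_take:
  assumes "u \<in> L j" "w \<in> L m" "m \<le> j" "take m u \<noteq> w"
  shows "incomp w u"
proof -
  have "\<not> prefix w u" "\<not> prefix u w"
    using assms by (auto simp: tree_level_def prefix_def)
  then show ?thesis using assms by (auto simp: incomp_def tree_level_def)
qed

text \<open>The subtrees at incomparable vertices are disjoint, and each element preserves its own
  subtree and fixes everything outside it.\<close>

lemma rist_commute:
  assumes "incomp u v" "a \<in> K u" "b \<in> K v"
  shows "a \<odot> b = b \<odot> a"
proof (rule tree_aut_eqI[of _ A])
  show "a \<odot> b \<in> carrier (tree_aut A)" "b \<odot> a \<in> carrier (tree_aut A)"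
    using assms rist_G G_aut by auto
  fix w assume w: "w \<in> V"
  have disj: "\<not> (z \<in> subtree A u \<and> z \<in> subtree A v)" for z
    using assms(1) prefix_same_cases[of u z v] by (auto simp: incomp_def subtree_def parallel_def)
  have a: "z \<in> V \<Longrightarrow> z \<notin> subtree A u \<Longrightarrow> a z = z" and b: "z \<in> V \<Longrightarrow> z \<notin> subtree A v \<Longrightarrow> b z = z" for z
    using assms by (auto simp: rist_def)
  have "a (b w) = b (a w)"
    using w a b disj[of w] disj[of "a w"] disj[of "b w"] rist_subtree[OF assms(2), of w]
      rist_subtree[OF assms(3), of w] vert_closed[OF rist_G[OF assms(2)] w] vert_closed[OF rist_G[OF assms(3)] w]
    by metis
  then show "(a \<odot> b) w = (b \<odot> a) w"
    using assms w rist_G by (simp add: vert_mult)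
qed

lemma act_commute:
  "\<lbrakk>incomp u v; a \<in> K u; b \<in> K v; x \<in> X\<rbrakk> \<Longrightarrow> \<phi> a (\<phi> b x) = \<phi> b (\<phi> a x)"
  using rist_commute[of u v a b] rist_G[of a u] rist_G[of b v] by (metis act_mult)

lemma rist_conj:
  assumes "g \<in> G" "v \<in> V" "a \<in> K v"
  obtains a' where "a' \<in> K (g v)" "\<And>x. x \<in> X \<Longrightarrow> \<phi> a' (\<phi> g x) = \<phi> g (\<phi> a x)"
proof (rule that)
  have a: "a \<in> G" using assms rist_G by blast
  show "g \<odot> a \<odot> \<iota> g \<in> K (g v)"
    unfolding rist_def
  proof (intro CollectI conjI ballI)
    fix w assume w: "w \<in> V - subtree A (g v)"
    then have "\<not> prefix (g v) (g ((\<iota> g) w))" using assms by (auto simp: subtree_def)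
    then have "(\<iota> g) w \<in> V - subtree A v"
      using w assms tree_aut_prefix_iff[OF G_aut[OF assms(1)], of v "(\<iota> g) w"] by (auto simp: subtree_def)
    then have "a ((\<iota> g) w) = (\<iota> g) w" using assms by (auto simp: rist_def)
    then show "(g \<odot> a \<odot> \<iota> g) w = w" using assms a w by (simp add: vert_mult)
  qed (use assms a in auto)
  show "\<phi> (g \<odot> a \<odot> \<iota> g) (\<phi> g x) = \<phi> g (\<phi> a x)" if "x \<in> X" for x
    using assms a that by (simp add: act_mult)
qed

text \<open>By transitivity, for each \<open>d < j\<close> some \<open>g\<close> makes
  \<open>v\<close> and \<open>g v\<close> branch apart exactly at depth \<open>d\<close>, and
  \<open>g v\<close> is assigned to \<open>g x\<close>. Moving the pair \<open>x\<close>,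
  \<open>g x\<close> into \<open>S\<close> preserves this depth. So every \<open>d < j\<close> is
  the branching depth of two vertices assigned to points of \<open>S\<close>, which leaves only
  \<open>(card S * b)\<^sup>2\<close> choices.\<close>

lemma level_bound:
  assumes E: "\<And>x. x \<in> X \<Longrightarrow> E x \<subseteq> L j" "\<And>x. x \<in> X \<Longrightarrow> card (E x) \<le> b"
    and equivariant: "\<And>g x v. \<lbrakk>g \<in> G; x \<in> X; v \<in> E x\<rbrakk> \<Longrightarrow> g v \<in> E (\<phi> g x)"
    and ne: "x \<in> X" "v \<in> E x"
  shows "j \<le> (card S * b)\<^sup>2"
proof -
  define P where "P = (SIGMA s:S. E s)"
  \<comment> \<open>\<open>split d u w\<close> says that the longest common prefix of
    \<open>u\<close> and \<open>w\<close> has length \<open>d\<close>.\<close>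
  define split where
    "split d u w \<longleftrightarrow> take d u = take d w \<and> take (Suc d) u \<noteq> take (Suc d) w" for d and u w :: "'a list"
  have split_unique: "d = d'" if "split d u w" "split d' u w" for d d' u w
  proof (rule ccontr)
    assume "d \<noteq> d'"
    then consider "Suc d \<le> d'" | "Suc d' \<le> d" by linarith
    then show False
      using that unfolding split_def by cases (metis min.absorb1 take_take)+
  qed
  have finE: "finite (E x)" if "x \<in> X" for x
    using E(1)[OF that] finite_tree_level[of A j, OF alphabet(1)] by (rule finite_subset)
  then have fin: "finite P"
    unfolding P_def using finite_S S_sub by (intro finite_SigmaI) auto
  have "card P = (\<Sum>s\<in>S. card (E s))"
    unfolding P_def using finite_S S_sub finE by (intro card_SigmaI) auto
  also have "\<dots> \<le> card S * b"
    using sum_bounded_above[of S "\<lambda>s. card (E s)" b] E(2) S_sub by auto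
  finally have card_P: "card P \<le> card S * b" .
  define f where "f = (\<lambda>((s :: 'x, u), (t :: 'x, w)). THE d. split d u w)"
  have "{..<j} \<subseteq> f ` (P \<times> P)"
  proof
    fix d assume d: "d \<in> {..<j}"
    have v: "v \<in> L j" using E(1) ne by blast
    obtain w where w: "w \<in> L j" "take d w = take d v" "take (Suc d) w \<noteq> take (Suc d) v"
      using tree_level_branch[OF v _ alphabet(2)] d by auto
    obtain g where g: "g \<in> G" "g v = w" using level_transitive[OF v w(1)] by blast
    obtain k where k: "k \<in> G" "\<phi> k x \<in> S" "\<phi> k (\<phi> g x) \<in> S"
      using pairs[of x "\<phi> g x"] g ne by auto
    have "k v \<in> E (\<phi> k x)" "k w \<in> E (\<phi> k (\<phi> g x))"
      using equivariant[OF g(1) ne] equivariant[OF k(1) ne] equivariant[OF k(1), of "\<phi> g x" w] g ne by auto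
    then have "((\<phi> k x, k v), (\<phi> k (\<phi> g x), k w)) \<in> P \<times> P" using k by (auto simp: P_def)
    moreover have "split d (k v) (k w)"
      using w v level_vert(1)[OF v] level_vert(1)[OF w(1)] k(1)
      unfolding split_def
      by (simp add: tree_aut_eq_iff[OF G_aut] tree_verts_take flip: tree_aut_take[OF G_aut])
    then have "f ((\<phi> k x, k v), (\<phi> k (\<phi> g x), k w)) = d"
      using split_unique by (auto simp: f_def)
    ultimately show "d \<in> f ` (P \<times> P)" by (metis imageI)
  qed
  then have "j \<le> card (P \<times> P)"
    using fin by (metis card_lessThan card_image_le card_mono finite_cartesian_product finite_imageI le_trans)
  also have "\<dots> \<le> (card S * b)\<^sup>2"
    using card_P by (simp add: card_cartesian_product power2_eq_square mult_mono)
  finally show ?thesis .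
qed

section \<open>Deep levels and normality of point stabilizers\<close>

definition deep :: "nat \<Rightarrow> bool" where
  "deep n \<longleftrightarrow> (\<forall>x\<in>X. \<forall>v\<in>V. n \<le> length v \<longrightarrow>
     (\<forall>a\<in>K v. \<forall>j. \<exists>u\<in>L j. \<exists>b\<in>K u. \<phi> b x = \<phi> a x))"

text \<open>\<open>Z s t\<close> is the set of levels on which some rigid stabilizer carries
  \<open>s\<close> to \<open>t\<close>. Take \<open>n\<close> above all elements of the finitely
  many finite sets \<open>Z s t\<close> with \<open>s\<close>, \<open>t\<close> in \<open>S\<close>.
  A move made from level \<open>n\<close> or below, translated into \<open>S\<close>, then belongs
  to an infinite \<open>Z s t\<close>, so it can also be made from beyond level
  \<open>j\<close>.\<close>

lemma deep_exists: "\<exists>n. deep n"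
proof -
  define Z where "Z s t = {length v |v. v \<in> V \<and> (\<exists>a\<in>K v. t = \<phi> a s)}" for s t
  have "finite (\<Union>p\<in>{p\<in>S \<times> S. finite (Z (fst p) (snd p))}. Z (fst p) (snd p))"
    using finite_S by auto
  then obtain n where n': "\<forall>m\<in>(\<Union>p\<in>{p\<in>S \<times> S. finite (Z (fst p) (snd p))}. Z (fst p) (snd p)). m < n"
    unfolding finite_nat_set_iff_bounded by blast
  have n: "m < n" if "s \<in> S" "t \<in> S" "finite (Z s t)" "m \<in> Z s t" for s t m
    by (rule n'[rule_format], rule UN_I[of "(s, t)"]) (use that in auto)
  have "\<exists>u\<in>L j. \<exists>b\<in>K u. \<phi> b x = \<phi> a x"
    if x: "x \<in> X" and v: "v \<in> V" "n \<le> length v" and a: "a \<in> K v" for x v a j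
  proof -
    have aG: "a \<in> G" using a rist_G by blast
    obtain k where k: "k \<in> G" "\<phi> k x \<in> S" "\<phi> k (\<phi> a x) \<in> S"
      using pairs[of x "\<phi> a x"] aG x by auto
    obtain a' where a': "a' \<in> K (k v)" "\<phi> a' (\<phi> k x) = \<phi> k (\<phi> a x)"
      using rist_conj[OF k(1) v(1) a] x by metis
    have "length v \<in> Z (\<phi> k x) (\<phi> k (\<phi> a x))"
      unfolding Z_def using a'(1) a'(2)[symmetric] v k tree_aut_length[OF G_aut[OF k(1)] v(1)]
      by (intro CollectI exI[of _ "k v"] conjI bexI[of _ a']) auto
    then have "infinite (Z (\<phi> k x) (\<phi> k (\<phi> a x)))"
      using n[OF k(2,3)] v(2) by fastforce
    then obtain m where "m \<in> Z (\<phi> k x) (\<phi> k (\<phi> a x))" "m \<ge> j"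
      unfolding infinite_nat_iff_unbounded_le by blast
    then obtain w c where w: "w \<in> V" "length w \<ge> j" and c: "c \<in> K w" "\<phi> k (\<phi> a x) = \<phi> c (\<phi> k x)"
      by (auto simp: Z_def)
    \<comment> \<open>Cutting the vertex back to level \<open>j\<close> only enlarges its rigid
      stabilizer.\<close>
    let ?w = "take j w"
    have w': "?w \<in> L j" "?w \<in> V" using w by (auto simp: tree_level_def tree_verts_take)
    have c': "c \<in> K ?w" using c(1) rist_take by blast
    obtain b where "b \<in> K ((\<iota> k) ?w)" "\<phi> b (\<phi> (\<iota> k) (\<phi> k x)) = \<phi> (\<iota> k) (\<phi> c (\<phi> k x))"
      using rist_conj[of "\<iota> k", OF _ w'(2) c'] k x by (metis G_closed(2) act_closed)
    moreover from this(2) have "\<phi> b x = \<phi> a x"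
      using k(1) x aG by (simp flip: c(2))
    moreover have "(\<iota> k) ?w \<in> L j" using k(1) w'(1) by simp
    ultimately show ?thesis by blast
  qed
  then show ?thesis unfolding deep_def by blast
qed

text \<open>A vertex \<open>w\<close> is bad at \<open>x\<close> if the stabilizer of \<open>x\<close> in \<open>Rist(w)\<close> is not normal in \<open>Rist(w)\<close>.\<close>

definition bad :: "'x \<Rightarrow> 'a list \<Rightarrow> bool" where
  "bad x w \<longleftrightarrow> (\<exists>a\<in>K w. \<exists>p\<in>K w. \<phi> p x = x \<and> \<phi> p (\<phi> a x) \<noteq> \<phi> a x)"

lemma bad_equivariant:
  assumes "g \<in> G" "x \<in> X" "w \<in> V" "bad x w"
  shows "bad (\<phi> g x) (g w)"
proof -
  obtain a p where ap: "a \<in> K w" "p \<in> K w" "\<phi> p x = x" "\<phi> p (\<phi> a x) \<noteq> \<phi> a x"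
    using assms(4) by (auto simp: bad_def)
  obtain a' where a': "a' \<in> K (g w)" "\<And>x. x \<in> X \<Longrightarrow> \<phi> a' (\<phi> g x) = \<phi> g (\<phi> a x)"
    using rist_conj[OF assms(1,3) ap(1)] by blast
  obtain p' where p': "p' \<in> K (g w)" "\<And>x. x \<in> X \<Longrightarrow> \<phi> p' (\<phi> g x) = \<phi> g (\<phi> p x)"
    using rist_conj[OF assms(1,3) ap(2)] by blast
  have "\<phi> a x \<in> X" "\<phi> p (\<phi> a x) \<in> X" using ap rist_G assms by auto
  then have "\<phi> p' (\<phi> g x) = \<phi> g x" "\<phi> p' (\<phi> a' (\<phi> g x)) \<noteq> \<phi> a' (\<phi> g x)"
    using a'(2) p'(2) ap assms by (auto simp: act_eq_iff)
  then show ?thesis using a'(1) p'(1) by (auto simp: bad_def)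
qed

text \<open>\<open>p\<close> fixes \<open>x\<close> and commutes with \<open>b\<close>, so it fixes
  \<open>b x\<close>, which is \<open>a' (a x)\<close>. As \<open>p\<close> also commutes with
  \<open>a'\<close>, it fixes \<open>a x\<close>.\<close>

lemma fixes_orbit:
  assumes "incomp w w'" "incomp w u"
    and "a \<in> K w" "p \<in> K w" "a' \<in> K w'" "b \<in> K u" "x \<in> X"
    and eq: "\<phi> b x = \<phi> a (\<phi> a' x)" and "\<phi> p x = x"
  shows "\<phi> p (\<phi> a x) = \<phi> a x"
proof -
  note G = assms(3-6)[THEN rist_G]
  have c: "\<phi> a' (\<phi> q x) = \<phi> q (\<phi> a' x)" if "q \<in> K w" "x \<in> X" for q x
    using act_commute[OF assms(1) that(1) assms(5) that(2)] by simp
  have "\<phi> a' (\<phi> p (\<phi> a x)) = \<phi> p (\<phi> b x)"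
    using assms G by (simp add: c)
  also have "\<dots> = \<phi> b x"
    using act_commute[OF assms(2,4,6,7)] assms by simp
  also have "\<dots> = \<phi> a' (\<phi> a x)"
    using assms G by (simp add: c)
  finally show ?thesis
    using G assms(7) by (simp add: act_eq_iff)
qed

text \<open>Below one vertex of the deep level \<open>n\<close>, the product \<open>a a'\<close> of
  witnesses for two bad vertices can be imitated at \<open>x\<close> from some \<open>u\<close> of
  level \<open>j\<close>. This \<open>u\<close> differs from \<open>w\<close> or from
  \<open>w'\<close>, and \<open>fixes_orbit\<close> refutes badness of that vertex.\<close>

lemma bad_unique:
  assumes "deep n" "n \<le> j" "x \<in> X" "w \<in> L j" "w' \<in> L j" "take n w = take n w'"
    and "bad x w" "bad x w'"
  shows "w = w'"
proof (rule ccontr)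
  assume ne: "w \<noteq> w'"
  obtain a p where ap: "a \<in> K w" "p \<in> K w" "\<phi> p x = x" "\<phi> p (\<phi> a x) \<noteq> \<phi> a x"
    using assms(7) by (auto simp: bad_def)
  obtain a' p' where ap': "a' \<in> K w'" "p' \<in> K w'" "\<phi> p' x = x" "\<phi> p' (\<phi> a' x) \<noteq> \<phi> a' x"
    using assms(8) by (auto simp: bad_def)
  let ?v = "take n w"
  have v: "?v \<in> V" "length ?v = n"
    using assms(2,4) tree_level_take[OF assms(4,2)] by (auto simp: tree_level_def)
  have "a \<odot> a' \<in> K ?v"
    using ap(1) ap'(1) rist_take[of w n] rist_take[of w' n] assms(6) by (auto intro: rist_mult)
  then obtain u b where u: "u \<in> L j" "b \<in> K u" "\<phi> b x = \<phi> a (\<phi> a' x)"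
    using assms(1,3) v ap(1) ap'(1) rist_G unfolding deep_def
    by (metis act_mult order_refl)
  have inc: "incomp w w'" using assms ne by (auto intro: incomp_level)
  show False
  proof (cases "u = w")
    case False
    then have "incomp w u" using assms u by (auto intro: incomp_level)
    from fixes_orbit[OF inc this ap(1,2) ap'(1) u(2) assms(3) u(3) ap(3)] ap(4) show False by simp
  next
    case True
    then have "incomp w' u" using assms u ne by (auto intro: incomp_level)
    moreover have "\<phi> b x = \<phi> a' (\<phi> a x)"
      using u(3) act_commute[OF inc ap(1) ap'(1) assms(3)] by simp
    ultimately show False
      using fixes_orbit[OF incomp_sym[OF inc] _ ap'(1,2) ap(1) u(2) assms(3) _ ap'(3)] ap'(4) by simp
  qed
qed

definition tame :: "nat \<Rightarrow> bool" where
  "tame m \<longleftrightarrow> deep m \<and> (\<forall>x\<in>X. \<forall>j\<ge>m. \<forall>w\<in>L j. \<not> bad x w)"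

lemma finite_level: "finite (L n)"
  by (rule finite_tree_level) (rule alphabet)

lemma card_le_by_take:
  assumes "n \<le> j" "E \<subseteq> L j" "inj_on (take n) E"
  shows "card E \<le> card (L n)"
  using assms tree_level_take[of _ A j n] by (intro card_inj_on_le[OF _ _ finite_level]) auto

text \<open>By \<open>bad_unique\<close> the bad vertices of level \<open>j\<close> at a point
  inject into level \<open>n\<close>. Their number is bounded independently of \<open>j\<close>, so
  \<open>level_bound\<close> excludes them on all large levels.\<close>

lemma tame_exists: "\<exists>m. tame m"
proof -
  obtain n where n: "deep n" using deep_exists by blast
  define m where "m = max n (Suc ((card S * card (L n))\<^sup>2))"
  have "deep m" using n by (auto simp: deep_def m_def)
  moreover have "\<not> bad x w" if "x \<in> X" "j \<ge> m" "w \<in> L j" for x j w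
  proof
    assume bad: "bad x w"
    have nj: "n \<le> j" using that by (simp add: m_def)
    have "j \<le> (card S * card (L n))\<^sup>2"
    proof (rule level_bound[where E = "\<lambda>x. {w \<in> L j. bad x w}"])
      show "card {w \<in> L j. bad x w} \<le> card (L n)" if "x \<in> X" for x
        using nj bad_unique[OF n nj that] by (intro card_le_by_take) (auto simp: inj_on_def)
      show "g v \<in> {w \<in> L j. bad (\<phi> g x) w}" if "g \<in> G" "x \<in> X" "v \<in> {w \<in> L j. bad x w}" for g x v
        using that bad_equivariant level_vert by auto
    qed (use that bad in auto)
    then show False using that(2) by (simp add: m_def)
  qed
  ultimately show ?thesis unfolding tame_def by blast
qed

section \<open>Rigid stabilizers that act non-commutatively, and transfer to other vertices\<close>

definition nonab :: "'x \<Rightarrow> 'a list \<Rightarrow> bool" where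
  "nonab x w \<longleftrightarrow> (\<exists>a\<in>K w. \<exists>b\<in>K w. \<phi> a (\<phi> b x) \<noteq> \<phi> b (\<phi> a x))"

lemma nonab_equivariant:
  assumes "g \<in> G" "x \<in> X" "w \<in> V" "nonab x w"
  shows "nonab (\<phi> g x) (g w)"
proof -
  obtain a b where ab: "a \<in> K w" "b \<in> K w" "\<phi> a (\<phi> b x) \<noteq> \<phi> b (\<phi> a x)"
    using assms(4) by (auto simp: nonab_def)
  obtain a' where a': "a' \<in> K (g w)" "\<And>x. x \<in> X \<Longrightarrow> \<phi> a' (\<phi> g x) = \<phi> g (\<phi> a x)"
    using rist_conj[OF assms(1,3) ab(1)] by blast
  obtain b' where b': "b' \<in> K (g w)" "\<And>x. x \<in> X \<Longrightarrow> \<phi> b' (\<phi> g x) = \<phi> g (\<phi> b x)"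
    using rist_conj[OF assms(1,3) ab(2)] by blast
  have "\<phi> a x \<in> X" "\<phi> b x \<in> X" "\<phi> a (\<phi> b x) \<in> X" "\<phi> b (\<phi> a x) \<in> X"
    using ab rist_G assms by auto
  then have "\<phi> a' (\<phi> b' (\<phi> g x)) \<noteq> \<phi> b' (\<phi> a' (\<phi> g x))"
    using a'(2) b'(2) ab assms by (auto simp: act_eq_iff)
  then show ?thesis using a'(1) b'(1) by (auto simp: nonab_def)
qed

lemma nonab_iff:
  assumes "g \<in> G" "x \<in> X" "w \<in> V"
  shows "nonab (\<phi> g x) (g w) \<longleftrightarrow> nonab x w"
  using nonab_equivariant[OF assms] nonab_equivariant[of "\<iota> g" "\<phi> g x" "g w"] assms by auto

abbreviation noncomm :: "'x \<Rightarrow> ('a list \<Rightarrow> 'a list) \<Rightarrow> ('a list \<Rightarrow> 'a list) \<Rightarrow> bool" where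
  "noncomm x a b \<equiv> \<phi> a (\<phi> b x) \<noteq> \<phi> b (\<phi> a x)"

definition reach :: "'x \<Rightarrow> 'a list \<Rightarrow> ('a list \<Rightarrow> 'a list) \<Rightarrow> bool" where
  "reach x u a \<longleftrightarrow> (\<exists>b\<in>K u. \<phi> b x = \<phi> a x)"

text \<open>At \<open>x\<close> the elements \<open>a\<close> and \<open>a'\<close> can be replaced
  by \<open>b\<close> and \<open>b'\<close>, which commute with each other and with
  \<open>K w\<close>. Its contrapositive is used throughout: vertices imitating two non-commuting
  elements must coincide.\<close>

lemma reach_commute:
  assumes "incomp w u" "incomp w u'" "incomp u u'"
    and "a \<in> K w" "a' \<in> K w" "reach x u a" "reach x u' a'" "x \<in> X"
  shows "\<not> noncomm x a a'"
proof -
  obtain b b' where b: "b \<in> K u" "\<phi> b x = \<phi> a x" "b' \<in> K u'" "\<phi> b' x = \<phi> a' x"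
    using assms by (auto simp: reach_def)
  have "\<phi> a (\<phi> a' x) = \<phi> b' (\<phi> a x)"
    using act_commute[OF assms(2,4) b(3) assms(8)] b(4) by simp
  also have "\<dots> = \<phi> b (\<phi> a' x)"
    using act_commute[OF assms(3) b(1,3) assms(8)] b(2,4) by simp
  also have "\<dots> = \<phi> a' (\<phi> a x)"
    using act_commute[OF assms(1,5) b(1) assms(8)] b(2) by simp
  finally show ?thesis by simp
qed

text \<open>Together with \<open>reach_inv\<close>: for incomparable \<open>w\<close> and
  \<open>u\<close>, the elements of \<open>K w\<close> that can be imitated at \<open>x\<close> from
  \<open>u\<close> form a subgroup. This later recovers factors from products.\<close>

lemma reach_mult:
  assumes "incomp w u" "a \<in> K w" "a' \<in> K w" "reach x u a" "reach x u a'" "x \<in> X"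
  shows "reach x u (a \<odot> a')"
proof -
  obtain b b' where b: "b \<in> K u" "\<phi> b x = \<phi> a x" "b' \<in> K u" "\<phi> b' x = \<phi> a' x"
    using assms by (auto simp: reach_def)
  have "\<phi> (b' \<odot> b) x = \<phi> (a \<odot> a') x"
    using act_commute[OF assms(1,2) b(3) assms(6)] b assms rist_G by (simp add: act_mult)
  then show ?thesis using rist_mult[OF b(3,1)] by (auto simp: reach_def)
qed

lemma reach_inv:
  assumes "incomp w u" "a \<in> K w" "reach x u a" "x \<in> X"
  shows "reach x u (\<iota> a)"
proof -
  obtain b where b: "b \<in> K u" "\<phi> b x = \<phi> a x"
    using assms by (auto simp: reach_def)
  have G: "a \<in> G" "b \<in> G" using assms b rist_G by auto
  have "\<phi> a (\<phi> (\<iota> b) x) = \<phi> (\<iota> b) (\<phi> a x)"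
    using act_commute[OF assms(1,2) rist_inv[OF b(1)] assms(4)] .
  also have "\<dots> = x" using G assms(4) by (simp flip: b(2))
  finally have "\<phi> (\<iota> b) x = \<phi> (\<iota> a) x"
    using G assms(4) by (metis act_inv(2) act_closed G_closed(2))
  then show ?thesis using rist_inv[OF b(1)] by (auto simp: reach_def)
qed

text \<open>The quotient of \<open>a\<close> and \<open>b\<close> fixes \<open>x\<close>, hence the
  whole orbit of \<open>x\<close> under \<open>K w\<close>, since the stabilizer is normal there.
  Elements of \<open>K w\<close> are thus determined on this orbit by their value at
  \<open>x\<close>.\<close>

lemma tame_eq:
  assumes "tame m" "w \<in> L m" "x \<in> X" "a \<in> K w" "b \<in> K w" "\<phi> a x = \<phi> b x" "d \<in> K w"
  shows "\<phi> a (\<phi> d x) = \<phi> b (\<phi> d x)"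
proof -
  have G: "a \<in> G" "b \<in> G" "d \<in> G" using assms rist_G by auto
  have "\<iota> b \<odot> a \<in> K w" using assms by (intro rist_mult rist_inv)
  moreover have "\<phi> (\<iota> b \<odot> a) x = x" using assms G by (simp add: act_mult)
  moreover have "\<not> bad x w" using assms by (auto simp: tame_def)
  ultimately have "\<phi> (\<iota> b \<odot> a) (\<phi> d x) = \<phi> d x" using assms(7) by (auto simp: bad_def)
  then show ?thesis using G assms(3) by (metis act_inv(1) act_mult act_closed G_closed(2))
qed

text \<open>The imitating element \<open>b\<close> commutes with \<open>a'\<close>, and by
  \<open>tame_eq\<close> it agrees with \<open>a c\<close> at \<open>a' x\<close> as well as at
  \<open>x\<close>. So \<open>a c\<close> commutes with \<open>a'\<close> at \<open>x\<close>, and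
  \<open>c\<close> cancels because it commutes with \<open>K u1\<close>.\<close>

lemma reach_inside:
  assumes "tame m" "m \<le> j" "x \<in> X" "u1 \<in> L j" "u2 \<in> L j" "u \<in> L j" "u \<noteq> u1" "u1 \<noteq> u2"
    and "take m u2 = take m u1" "take m u = take m u1"
    and "a \<in> K u1" "a' \<in> K u1" "c \<in> K u2" "reach x u (a \<odot> c)"
  shows "\<not> noncomm x a a'"
proof -
  let ?w = "take m u1"
  have w: "?w \<in> L m" using tree_level_take assms by blast
  have Kw: "a \<in> K ?w" "a' \<in> K ?w" "c \<in> K ?w" "a \<odot> c \<in> K ?w"
    using assms(11-13) rist_take[of u1 m] rist_take[of u2 m] assms(9) by (auto intro: rist_mult)
  note G = Kw[THEN rist_G]
  obtain b where b: "b \<in> K u" "\<phi> b x = \<phi> (a \<odot> c) x" using assms(14) by (auto simp: reach_def)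
  have bw: "b \<in> K ?w" using b rist_take[of u m] assms(10) by auto
  have inc: "incomp u1 u2" "incomp u1 u" using assms by (auto intro: incomp_level)
  have c: "\<phi> q (\<phi> c y) = \<phi> c (\<phi> q y)" if "q \<in> K u1" "y \<in> X" for q y
    using act_commute[OF inc(1) that(1) assms(13) that(2)] .
  have "\<phi> c (\<phi> a' (\<phi> a x)) = \<phi> a' (\<phi> (a \<odot> c) x)"
    using assms G by (simp add: act_mult c)
  also have "\<dots> = \<phi> b (\<phi> a' x)"
    using act_commute[OF inc(2) assms(12) b(1) assms(3)] b(2) by simp
  also have "\<dots> = \<phi> (a \<odot> c) (\<phi> a' x)"
    using tame_eq[OF assms(1) w assms(3) bw Kw(4) b(2) Kw(2)] .
  also have "\<dots> = \<phi> c (\<phi> a (\<phi> a' x))"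
    using assms G by (simp add: act_mult c)
  finally show ?thesis using G assms(3) by (simp add: act_eq_iff)
qed

text \<open>A vertex \<open>u\<close> below the same vertex of level \<open>m\<close> differs from
  \<open>u1\<close> or from \<open>u2\<close>; \<open>reach_inside\<close> applies to that one, with
  the two roles exchanged in the second case.\<close>

lemma reach_outside:
  assumes "tame m" "m \<le> j" "x \<in> X" "u1 \<in> L j" "u2 \<in> L j" "u \<in> L j" "u1 \<noteq> u2"
    and "take m u2 = take m u1"
    and "a \<in> K u1" "a' \<in> K u1" "c \<in> K u2" "c' \<in> K u2" "noncomm x a a'" "noncomm x c c'"
    and "reach x u (a \<odot> c)"
  shows "take m u \<noteq> take m u1"
proof
  assume eq: "take m u = take m u1"
  show False
  proof (cases "u = u1")
    case False
    then show False using reach_inside[OF assms(1-6) False assms(7,8) eq assms(9-11,15)] assms(13) by simp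
  next
    case True
    have "a \<odot> c = c \<odot> a"
      using rist_commute[OF incomp_level[OF assms(4,5,7)] assms(9,11)] .
    then show False
      using reach_inside[OF assms(1-3,5,4,6) _ assms(7)[symmetric] _ _ assms(11,12,9)] assms True eq by simp
  qed
qed

lemma reach_exists:
  assumes "tame m" "x \<in> X" "w \<in> L m" "e \<in> K w"
  shows "\<exists>u\<in>L j. reach x u e"
  using assms by (auto simp: tame_def deep_def reach_def tree_level_def)

text \<open>The factor \<open>c\<close> forces any vertex imitating \<open>a c\<close>,
  \<open>a' c\<close> or \<open>a a' c\<close> to lie outside the subtree at
  \<open>take m u1\<close>. Non-commutation forces a single vertex for all three, and the subgroup
  property then separates \<open>a\<close>, \<open>c\<close> and \<open>a'\<close>.\<close>

lemma transfer_three: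
  assumes "tame m" "m \<le> j" "x \<in> X" "u1 \<in> L j" "u2 \<in> L j" "u1 \<noteq> u2" "take m u2 = take m u1"
    and "a \<in> K u1" "a' \<in> K u1" "c \<in> K u2" "c' \<in> K u2" "noncomm x a a'" "noncomm x c c'"
  shows "\<exists>u\<in>L j. take m u \<noteq> take m u1 \<and> reach x u a \<and> reach x u a' \<and> reach x u c"
proof -
  let ?w = "take m u1"
  have w: "?w \<in> L m" using tree_level_take assms by blast
  note G = assms(8-11)[THEN rist_G]
  have K1: "q \<in> K ?w" if "q \<in> K u1" for q using that rist_take by blast
  have Kw: "a \<in> K ?w" "a' \<in> K ?w" "c \<in> K ?w"
    using assms(8-10) rist_take[of u1 m] rist_take[of u2 m] assms(7) by auto
  have comm: "\<phi> q (\<phi> c y) = \<phi> c (\<phi> q y)" if "q \<in> K u1" "y \<in> X" for q y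
    using act_commute[OF incomp_level[OF assms(4,5,6)] that(1) assms(10) that(2)] .
  \<comment> \<open>Two different outside vertices would make \<open>q c\<close> and
    \<open>q' c\<close> commute at \<open>x\<close>; cancelling \<open>c\<close> twice contradicts
    the choice of \<open>q\<close> and \<open>q'\<close>.\<close>
  have same: "u = u'"
    if q: "q \<in> K u1" "q' \<in> K u1" "noncomm x q q'"
      and u: "u \<in> L j" "u' \<in> L j" "take m u \<noteq> ?w" "take m u' \<noteq> ?w"
      and r: "reach x u (q \<odot> c)" "reach x u' (q' \<odot> c)" for q q' u u'
  proof (rule ccontr)
    assume "u \<noteq> u'"
    have inc: "incomp ?w u" "incomp ?w u'" "incomp u u'"
      using u \<open>u \<noteq> u'\<close> w assms(2) by (auto intro: incomp_take incomp_level)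
    have "\<phi> (q \<odot> c) (\<phi> (q' \<odot> c) x) = \<phi> (q' \<odot> c) (\<phi> (q \<odot> c) x)"
      using reach_commute[OF inc _ _ r assms(3)] q Kw K1 by (auto intro: rist_mult)
    then have "\<phi> c (\<phi> c (\<phi> q (\<phi> q' x))) = \<phi> c (\<phi> c (\<phi> q' (\<phi> q x)))"
      using q(1,2)[THEN rist_G] G assms(3) by (simp add: act_mult comm q(1,2))
    then show False
      using q(3) G assms(3) q(1,2)[THEN rist_G] by (simp add: act_eq_iff)
  qed
  have ex: "\<exists>u\<in>L j. take m u \<noteq> ?w \<and> reach x u (q \<odot> c)"
    if q: "q \<in> K u1" "q' \<in> K u1" "noncomm x q q'" for q q'
  proof -
    obtain u where "u \<in> L j" "reach x u (q \<odot> c)"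
      using reach_exists[OF assms(1,3) w, of "q \<odot> c"] K1[OF q(1)] Kw(3) by (metis rist_mult)
    then show ?thesis
      using reach_outside[OF assms(1-5) _ assms(6,7) q(1,2) assms(10,11) q(3) assms(13)] by blast
  qed
  have aa': "a \<odot> a' \<in> K u1" "noncomm x (a \<odot> a') a"
    using assms G by (auto simp: act_mult act_eq_iff intro: rist_mult)
  obtain u where u: "u \<in> L j" "take m u \<noteq> ?w" "reach x u (a \<odot> c)"
    using ex[OF assms(8,9,12)] by blast
  obtain u' where u': "u' \<in> L j" "take m u' \<noteq> ?w" "reach x u' (a' \<odot> c)"
    using ex[OF assms(9,8)] assms(12) by metis
  obtain u'' where u'': "u'' \<in> L j" "take m u'' \<noteq> ?w" "reach x u'' (a \<odot> a' \<odot> c)"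
    using ex[OF aa'(1) assms(8) aa'(2)] by blast
  have "u = u'" using same[OF assms(8,9,12) u(1) u'(1) u(2) u'(2) u(3) u'(3)] .
  have "u'' = u" using same[OF aa'(1) assms(8) aa'(2) u''(1) u(1) u''(2) u(2) u''(3) u(3)] .
  have inc: "incomp ?w u" using incomp_take[OF u(1) w assms(2) u(2)] .
  note carr = G[THEN G_aut]
  have Kw': "a \<odot> c \<in> K ?w" "a' \<odot> c \<in> K ?w" "a \<odot> a' \<odot> c \<in> K ?w"
    using Kw by (simp_all add: rist_mult)
  have r: "reach x u (a' \<odot> c)" "reach x u (a \<odot> a' \<odot> c)"
    using u'(3) u''(3) \<open>u = u'\<close> \<open>u'' = u\<close> by simp_all
  \<comment> \<open>The factors come out in this order: \<open>a\<close> from \<open>a a' c\<close>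
    and \<open>a' c\<close>, then \<open>c\<close> from \<open>a\<close> and \<open>a c\<close>,
    then \<open>a'\<close> from \<open>a' c\<close> and \<open>c\<close>.\<close>
  have "reach x u (a \<odot> a' \<odot> c \<odot> \<iota> (a' \<odot> c))"
    by (rule reach_mult[OF inc Kw'(3) rist_inv[OF Kw'(2)] r(2) reach_inv[OF inc Kw'(2) r(1) assms(3)] assms(3)])
  moreover have "a \<odot> a' \<odot> c \<odot> \<iota> (a' \<odot> c) = a"
    using carr by (simp add: T.m_assoc T.inv_mult_group) (simp flip: T.m_assoc)
  ultimately have ra: "reach x u a" by simp
  have "reach x u (\<iota> a \<odot> (a \<odot> c))"
    by (rule reach_mult[OF inc rist_inv[OF Kw(1)] Kw'(1) reach_inv[OF inc Kw(1) ra assms(3)] u(3) assms(3)])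
  moreover have "\<iota> a \<odot> (a \<odot> c) = c" using carr by (simp flip: T.m_assoc)
  ultimately have rc: "reach x u c" by simp
  have "reach x u (a' \<odot> c \<odot> \<iota> c)"
    by (rule reach_mult[OF inc Kw'(2) rist_inv[OF Kw(3)] r(1) reach_inv[OF inc Kw(3) rc assms(3)] assms(3)])
  moreover have "a' \<odot> c \<odot> \<iota> c = a'" using carr by (simp add: T.m_assoc)
  ultimately have "reach x u a'" by simp
  with ra rc u show ?thesis by blast
qed

text \<open>Apply \<open>transfer_three\<close> twice, with \<open>c\<close> and \<open>c'\<close>
  exchanged. Both resulting vertices imitate \<open>a\<close> and \<open>a'\<close>, so by
  \<open>reach_commute\<close> they are equal.\<close>

lemma transfer_both:
  assumes "tame m" "m \<le> j" "x \<in> X" "u1 \<in> L j" "u2 \<in> L j" "u1 \<noteq> u2" "take m u2 = take m u1"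
    and "a \<in> K u1" "a' \<in> K u1" "c \<in> K u2" "c' \<in> K u2" "noncomm x a a'" "noncomm x c c'"
  obtains u where "u \<in> L j" "take m u \<noteq> take m u1"
    "reach x u a" "reach x u a'" "reach x u c" "reach x u c'"
proof -
  obtain u where u: "u \<in> L j" "take m u \<noteq> take m u1" "reach x u a" "reach x u a'" "reach x u c"
    using transfer_three[OF assms] by blast
  obtain v where v: "v \<in> L j" "take m v \<noteq> take m u1" "reach x v a" "reach x v a'" "reach x v c'"
    using transfer_three[OF assms(1-9,11,10,12) assms(13)[symmetric]] by blast
  have "u = v"
  proof (rule ccontr)
    assume "u \<noteq> v"
    moreover have "u1 \<noteq> u" "u1 \<noteq> v" using u v by auto
    ultimately have "incomp u1 u" "incomp u1 v" "incomp u v"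
      using u(1) v(1) assms(4) by (auto intro: incomp_level)
    from reach_commute[OF this assms(8,9) u(3) v(4) assms(3)] assms(12) show False by simp
  qed
  with u v that show ?thesis by blast
qed

text \<open>Above each vertex of level \<open>m\<close> there is at most one isolated vertex of a given level, so their
  number is bounded independently of that level, as \<open>level_bound\<close> requires.\<close>

definition isolated :: "nat \<Rightarrow> 'x \<Rightarrow> 'a list \<Rightarrow> bool" where
  "isolated m x u \<longleftrightarrow> nonab x u \<and>
     (\<forall>v\<in>L (length u). take m v = take m u \<and> nonab x v \<longrightarrow> v = u)"

text \<open>Otherwise non-commuting vertices come in sibling pairs below level \<open>m\<close>. The
  pair \<open>u1\<close>, \<open>u2\<close> transfers to one vertex \<open>v\<close>, which inherits
  non-commutation and so has a sibling \<open>v'\<close>. Transferring \<open>v\<close>,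
  \<open>v'\<close> back must land at \<open>u1\<close> and also at \<open>u2\<close>, so a
  non-commuting pair in \<open>K v'\<close> is imitated from two different vertices, against
  \<open>reach_commute\<close>.\<close>

lemma isolated_exists:
  assumes "tame m" "m \<le> j" "x \<in> X" "u1 \<in> L j" "nonab x u1"
  shows "\<exists>u\<in>L j. isolated m x u"
proof (rule ccontr)
  assume none: "\<not> ?thesis"
  have sibling: "\<exists>v\<in>L j. take m v = take m u \<and> v \<noteq> u \<and> nonab x v" if "u \<in> L j" "nonab x u" for u
    using none that by (auto simp: isolated_def level_vert(2))
  obtain u2 where u2: "u2 \<in> L j" "take m u2 = take m u1" "u2 \<noteq> u1" "nonab x u2"
    using sibling[OF assms(4,5)] by blast
  obtain a a' where a: "a \<in> K u1" "a' \<in> K u1" "noncomm x a a'" using assms(5) by (auto simp: nonab_def)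
  obtain c c' where c: "c \<in> K u2" "c' \<in> K u2" "noncomm x c c'" using u2(4) by (auto simp: nonab_def)
  obtain v where v: "v \<in> L j" "take m v \<noteq> take m u1"
    "reach x v a" "reach x v a'" "reach x v c" "reach x v c'"
    by (rule transfer_both[OF assms(1-4) u2(1) u2(3)[symmetric] u2(2) a(1,2) c(1,2) a(3) c(3)])
  \<comment> \<open>The imitations in \<open>K v\<close> compose in the opposite order:
    \<open>b b' x = q' q x\<close>. Non-commutation survives this reversal.\<close>
  have pull: "\<exists>b\<in>K v. \<exists>b'\<in>K v. \<phi> b x = \<phi> q x \<and> \<phi> b' x = \<phi> q' x \<and> noncomm x b b'"
    if q: "q \<in> K u" "q' \<in> K u" "noncomm x q q'" "reach x v q" "reach x v q'"
      and u: "u \<in> L j" "u \<noteq> v" for u q q'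
  proof -
    obtain b b' where b: "b \<in> K v" "\<phi> b x = \<phi> q x" "b' \<in> K v" "\<phi> b' x = \<phi> q' x"
      using q by (auto simp: reach_def)
    have inc: "incomp u v" using u v(1) by (auto intro: incomp_level)
    have "\<phi> b (\<phi> b' x) = \<phi> q' (\<phi> q x)" "\<phi> b' (\<phi> b x) = \<phi> q (\<phi> q' x)"
      using act_commute[OF inc q(2) b(1) assms(3)] act_commute[OF inc q(1) b(3) assms(3)] b by simp_all
    then show ?thesis using b q(3) by (intro bexI[of _ b] bexI[of _ b']) auto
  qed
  have uv: "u1 \<noteq> v" "u2 \<noteq> v" using v u2 by auto
  obtain b1 b1' where b1: "b1 \<in> K v" "b1' \<in> K v" "\<phi> b1 x = \<phi> a x" "\<phi> b1' x = \<phi> a' x" "noncomm x b1 b1'"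
    using pull[OF a v(3,4) assms(4) uv(1)] by blast
  obtain b2 b2' where b2: "b2 \<in> K v" "b2' \<in> K v" "\<phi> b2 x = \<phi> c x" "\<phi> b2' x = \<phi> c' x" "noncomm x b2 b2'"
    using pull[OF c v(5,6) u2(1) uv(2)] by blast
  have "nonab x v" unfolding nonab_def using b1(1,2,5) by blast
  then obtain v' where v': "v' \<in> L j" "take m v' = take m v" "v' \<noteq> v" "nonab x v'"
    using sibling[OF v(1)] by blast
  obtain d d' where d: "d \<in> K v'" "d' \<in> K v'" "noncomm x d d'" using v'(4) by (auto simp: nonab_def)
  \<comment> \<open>The return vertex \<open>z\<close> imitates \<open>q'\<close> through
    \<open>b'\<close>, while \<open>v\<close> imitates \<open>q\<close>. If \<open>z\<close> were
    not \<open>u\<close>, then \<open>q\<close> and \<open>q'\<close> would commute at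
    \<open>x\<close>.\<close>
  have reach_back: "reach x u d \<and> reach x u d'"
    if q: "q \<in> K u" "q' \<in> K u" "noncomm x q q'" "reach x v q" 
      and b: "b \<in> K v" "b' \<in> K v" "\<phi> b x = \<phi> q x" "\<phi> b' x = \<phi> q' x" "noncomm x b b'"
      and u: "u \<in> L j" "u \<noteq> v" for u q q' b b'
  proof -
    obtain z where z: "z \<in> L j" "take m z \<noteq> take m v"
      "reach x z b" "reach x z b'" "reach x z d" "reach x z d'"
      by (rule transfer_both[OF assms(1-3) v(1) v'(1) v'(3)[symmetric] v'(2) b(1,2) d(1,2) b(5) d(3)])
    have "z = u"
    proof (rule ccontr)
      assume "z \<noteq> u"
      moreover have "z \<noteq> v" using z by auto
      ultimately have "incomp u v" "incomp u z" "incomp v z"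
        using u z(1) v(1) by (auto intro: incomp_level)
      moreover have "reach x z q'" using z(4) b(4) by (simp add: reach_def)
      ultimately show False using reach_commute[of u v z q q' x] q assms(3) by blast
    qed
    then show ?thesis using z by simp
  qed
  have "reach x u1 d" using reach_back[OF a v(3) b1 assms(4) uv(1)] by simp
  moreover have "reach x u2 d'" using reach_back[OF c v(5) b2 u2(1) uv(2)] by simp
  moreover have "v' \<noteq> u1" "v' \<noteq> u2" using v' v u2 by auto
  then have "incomp v' u1" "incomp v' u2" "incomp u1 u2"
    using v'(1) u2 assms(4) by (auto intro: incomp_level)
  ultimately show False using reach_commute[of v' u1 u2 d d' x] d assms(3) by blast
qed

text \<open>A non-commuting vertex of level \<open>j\<close> yields an isolated one, and isolated
  vertices form an equivariant family of size at most \<open>card (L m)\<close>. The chosen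
  \<open>j\<close> exceeds the resulting bound.\<close>

lemma abelian_level_exists: "\<exists>j. \<forall>x\<in>X. \<forall>u\<in>L j. \<not> nonab x u"
proof -
  obtain m where m: "tame m" using tame_exists by blast
  define j where "j = max m (Suc ((card S * card (L m))\<^sup>2))"
  have mj: "m \<le> j" by (simp add: j_def)
  have "\<not> nonab x u" if xu: "x \<in> X" "u \<in> L j" for x u
  proof
    assume "nonab x u"
    then obtain v where v: "v \<in> L j" "isolated m x v"
      using isolated_exists[OF m mj xu] by blast
    have "j \<le> (card S * card (L m))\<^sup>2"
    proof (rule level_bound[where E = "\<lambda>x. {w \<in> L j. isolated m x w}"])
      show "card {w \<in> L j. isolated m x w} \<le> card (L m)" if "x \<in> X" for x
      proof (rule card_le_by_take[OF mj])
        show "inj_on (take m) {w \<in> L j. isolated m x w}"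
        proof (rule inj_onI)
          fix v w assume "v \<in> {w \<in> L j. isolated m x w}" "w \<in> {w \<in> L j. isolated m x w}" "take m v = take m w"
          then show "v = w" using level_vert(2)[of w j] unfolding isolated_def by blast
        qed
      qed auto
      show "g w \<in> {w \<in> L j. isolated m (\<phi> g x) w}"
        if g: "g \<in> G" and x: "x \<in> X" and w: "w \<in> {w \<in> L j. isolated m x w}" for g x w
      proof -
        have w': "w \<in> L j" "w \<in> V" "length w = j" "g w \<in> L j" "isolated m x w"
          using w g level_vert by auto
        have "z = g w" if z: "z \<in> L j" "take m z = take m (g w)" "nonab (\<phi> g x) z" for z
        proof -
          let ?y = "(\<iota> g) z"
          have y: "?y \<in> L j" "?y \<in> V" "g ?y = z" using z g level_vert(1)[OF z(1)] by auto
          have "g (take m ?y) = g (take m w)"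
            using y w' z(2) g by (simp add: tree_aut_take[OF G_aut])
          then have "take m ?y = take m w"
            using y w' g by (simp add: tree_aut_eq_iff[OF G_aut] tree_verts_take)
          moreover have "nonab x ?y" using z(3) nonab_iff[OF g x y(2)] y(3) by simp
          ultimately show ?thesis using w' y by (auto simp: isolated_def)
        qed
        then show ?thesis
          using w' nonab_iff[OF g x w'(2)] by (auto simp: isolated_def level_vert(2))
      qed
    qed (use xu v in auto)
    then show False by (simp add: j_def)
  qed
  then show ?thesis by blast
qed

section \<open>A finite index subgroup acting through an abelian group\<close>

lemma generate_commute:
  assumes "H \<subseteq> G" "g \<in> G" "\<And>h x. \<lbrakk>h \<in> H; x \<in> X\<rbrakk> \<Longrightarrow> \<not> noncomm x g h"
    and "k \<in> generate (tree_aut A) H"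
  shows "k \<in> G \<and> (\<forall>x\<in>X. \<not> noncomm x g k)"
  using assms(4)
proof induction
  case one
  then show ?case using assms(2) by simp
next
  case (incl h)
  then show ?case using assms by blast
next
  case (inv h)
  have h: "h \<in> G" using inv assms(1) by blast
  have "\<phi> g (\<phi> (\<iota> h) x) = \<phi> (\<iota> h) (\<phi> g x)" if "x \<in> X" for x
  proof -
    have "\<phi> h (\<phi> g (\<phi> (\<iota> h) x)) = \<phi> g x"
      using assms(3)[OF inv, of "\<phi> (\<iota> h) x"] h assms(2) that by simp
    then show ?thesis using h assms(2) that by (metis act_inv(2) act_closed G_closed(2))
  qed
  then show ?case using h by simp
next
  case (eng h k)
  then show ?case using assms(2) by (simp add: act_mult)
qed

lemma rist_level_G: "rist_level A G j \<subseteq> G"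
  unfolding rist_level_def
  using rist_G by (intro T.generate_subgroup_incl[OF _ subgroup_G]) auto

lemma rist_level_commute:
  assumes "\<forall>x\<in>X. \<forall>u\<in>L j. \<not> nonab x u"
    and "g \<in> rist_level A G j" "h \<in> rist_level A G j" "x \<in> X"
  shows "\<phi> g (\<phi> h x) = \<phi> h (\<phi> g x)"
proof -
  let ?H = "\<Union>v\<in>L j. K v"
  have H: "?H \<subseteq> G" using rist_G by auto
  \<comment> \<open>Distinct vertices of level \<open>j\<close> have commuting rigid stabilizers;
    for equal vertices this is the choice of \<open>j\<close>. Commutation then extends from
    generators to the generated group, one argument at a time.\<close>
  have gens: "\<not> noncomm x a b" if ab: "a \<in> ?H" "b \<in> ?H" and x: "x \<in> X" for a b x
  proof -
    obtain u v where uv: "u \<in> L j" "a \<in> K u" "v \<in> L j" "b \<in> K v" using ab by blast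
    show ?thesis
    proof (cases "u = v")
      case True
      then show ?thesis using assms(1) x uv by (auto simp: nonab_def)
    qed (use act_commute[OF incomp_level[OF uv(1,3)] uv(2,4) x] in simp)
  qed
  have gen: "\<not> noncomm x k a" if ak: "a \<in> ?H" "k \<in> rist_level A G j" and x: "x \<in> X" for a k x
  proof -
    have "k \<in> G \<and> (\<forall>x\<in>X. \<not> noncomm x a k)"
    proof (rule generate_commute[OF H])
      show "a \<in> G" using ak(1) H by (rule rev_subsetD)
      show "k \<in> generate (tree_aut A) ?H" using ak(2) by (simp add: rist_level_def)
    qed (rule gens[OF ak(1)])
    then show ?thesis using x by metis
  qed
  have "h \<in> G \<and> (\<forall>x\<in>X. \<not> noncomm x g h)"
  proof (rule generate_commute[OF H])
    show "g \<in> G" using assms(2) rist_level_G by (rule rev_subsetD)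
    show "h \<in> generate (tree_aut A) ?H" using assms(3) by (simp add: rist_level_def)
  qed (rule gen[OF _ assms(2)])
  then show ?thesis using assms(4) by metis
qed

lemma finite_action_set: "finite X"
proof -
  obtain j where j: "\<forall>x\<in>X. \<forall>u\<in>L j. \<not> nonab x u"
    using abelian_level_exists by blast
  let ?R = "rist_level A G j"
  note RG = subsetD[OF rist_level_G]
  note comm = rist_level_commute[OF j]
  have sub: "subgroup ?R (tree_aut A)"
    unfolding rist_level_def using rist_G G_aut by (intro T.generate_is_subgroup) auto
  have Rinv: "\<iota> k \<in> ?R" if "k \<in> ?R" for k
    using subgroup.m_inv_closed[OF sub that] .
  have "finite ((\<lambda>g. ?R #>\<^bsub>tree_aut A\<^esub> g) ` G)"
  proof -
    have "rcosets\<^bsub>(tree_aut A)\<lparr>carrier := G\<rparr>\<^esub> ?R = (\<lambda>g. ?R #>\<^bsub>tree_aut A\<^esub> g) ` G"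
      by (auto simp: RCOSETS_def r_coset_def)
    then show ?thesis using branch by (metis branch_group_def)
  qed
  then obtain D where D: "finite D" "D \<subseteq> G"
    and cosets: "(\<lambda>g. ?R #>\<^bsub>tree_aut A\<^esub> g) ` G = (\<lambda>g. ?R #>\<^bsub>tree_aut A\<^esub> g) ` D"
    by (meson finite_subset_image order_refl)
  have decomp: "\<exists>k\<in>?R. \<exists>t\<in>D. g = k \<odot> t" if "g \<in> G" for g
  proof -
    have "?R #>\<^bsub>tree_aut A\<^esub> g \<in> (\<lambda>g. ?R #>\<^bsub>tree_aut A\<^esub> g) ` D"
      using that by (simp flip: cosets)
    then obtain t where t: "t \<in> D" "?R #>\<^bsub>tree_aut A\<^esub> g = ?R #>\<^bsub>tree_aut A\<^esub> t"
      by (rule imageE)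
    then have "g \<in> ?R #>\<^bsub>tree_aut A\<^esub> t"
      using T.rcos_self[OF G_aut[OF that] sub] by simp
    then show ?thesis using t(1) by (auto simp: r_coset_def)
  qed
  \<comment> \<open>Translating \<open>S\<close> by the coset representatives gives a finite set
    whose square meets every orbit of pairs under the smaller group \<open>?R\<close>.\<close>
  define S' where "S' = (\<Union>t\<in>D. \<phi> t ` S)"
  have S': "finite S'" "S' \<subseteq> X" using D finite_S S_sub by (auto simp: S'_def intro!: act_closed)
  have pairs': "\<exists>k\<in>?R. \<phi> k x \<in> S' \<and> \<phi> k y \<in> S'" if xy: "x \<in> X" "y \<in> X" for x y
  proof -
    obtain h where h: "h \<in> G" "\<phi> h x \<in> S" "\<phi> h y \<in> S" using pairs[OF xy] by blast
    \<comment> \<open>The cosets are right cosets, so the inverse of \<open>h\<close> is decomposed: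
      \<open>h\<inverse> = k t\<close> gives \<open>k\<inverse> = t h\<close>, which maps both
      points into \<open>S'\<close>.\<close>
    obtain k t where kt: "k \<in> ?R" "t \<in> D" "\<iota> h = k \<odot> t" using decomp[of "\<iota> h"] h by auto
    have tG: "t \<in> G" using kt D by blast
    have "\<phi> (\<iota> k) z = \<phi> t (\<phi> h z)" if "z \<in> X" for z
    proof -
      have "\<phi> k (\<phi> t (\<phi> h z)) = z"
        using h(1) that tG RG[OF kt(1)] by (simp flip: act_mult[of k t] kt(3))
      then show ?thesis using RG[OF kt(1)] h(1) that tG by (metis act_inv(2) act_closed)
    qed
    then show ?thesis
      using Rinv[OF kt(1)] kt(2) h xy by (intro bexI[of _ "\<iota> k"]) (auto simp: S'_def)
  qed
  \<comment> \<open>A point \<open>y\<close> in the orbit of \<open>x\<close> is determined by the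
    pair \<open>k x\<close>, \<open>k y\<close> in \<open>S'\<close>: if \<open>b\<close> in
    \<open>?R\<close> maps \<open>k x\<close> to \<open>k y\<close>, then commuting \<open>b\<close>
    past \<open>k\<close> gives \<open>b x = y\<close>.\<close>
  have orbit: "finite {\<phi> k x |k. k \<in> ?R}" if x: "x \<in> X" for x
  proof (rule finite_surj)
    let ?f = "\<lambda>(s, t). SOME y. \<exists>a\<in>?R. y = \<phi> a x \<and> \<phi> a s = t"
    show "finite (S' \<times> S')" using S' by simp
    show "{\<phi> k x |k. k \<in> ?R} \<subseteq> ?f ` (S' \<times> S')"
    proof
      fix y assume "y \<in> {\<phi> k x |k. k \<in> ?R}"
      then obtain a where a: "a \<in> ?R" "y = \<phi> a x" by blast
      have yX: "y \<in> X" using a x RG by simp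
      obtain k where k: "k \<in> ?R" "\<phi> k x \<in> S'" "\<phi> k y \<in> S'" using pairs'[OF x yX] by blast
      have shift: "\<phi> b (\<phi> k x) = \<phi> k (\<phi> b x)" if "b \<in> ?R" for b
        using comm[OF that k(1) x] .
      have "(SOME y'. \<exists>b\<in>?R. y' = \<phi> b x \<and> \<phi> b (\<phi> k x) = \<phi> k y) = y"
      proof (rule some_equality)
        show "\<exists>b\<in>?R. y = \<phi> b x \<and> \<phi> b (\<phi> k x) = \<phi> k y" using a shift[OF a(1)] by auto
        show "y' = y" if "\<exists>b\<in>?R. y' = \<phi> b x \<and> \<phi> b (\<phi> k x) = \<phi> k y" for y'
          using that shift act_eq_iff[OF RG[OF k(1)]] RG x yX by auto
      qed
      then show "y \<in> ?f ` (S' \<times> S')"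
        using k by (intro image_eqI[of _ _ "(\<phi> k x, \<phi> k y)"]) auto
    qed
  qed
  have "X \<subseteq> (\<Union>s\<in>S'. {\<phi> k s |k. k \<in> ?R})"
  proof
    fix x assume x: "x \<in> X"
    obtain k where k: "k \<in> ?R" "\<phi> k x \<in> S'" using pairs'[OF x x] by blast
    then have "x = \<phi> (\<iota> k) (\<phi> k x)" using RG[OF k(1)] x by simp
    then show "x \<in> (\<Union>s\<in>S'. {\<phi> k s |k. k \<in> ?R})" using k Rinv[OF k(1)] by blast
  qed
  then show ?thesis
    using S' orbit by (meson finite_UN_I finite_subset subsetD)
qed

end

theorem corollary1p3:
  fixes A :: "nat \<Rightarrow> 'a set"
    and G :: "('a list \<Rightarrow> 'a list) set"
    and X :: "'x set"
    and \<phi> :: "('a list \<Rightarrow> 'a list) \<Rightarrow> 'x \<Rightarrow> 'x"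
    and W :: "('w, 'm) monoid_scheme"
  assumes "\<And>i. finite (A i)" and "\<And>i. card (A i) \<ge> 2"
    and "branch_group A G"
    and "group_action ((tree_aut A)\<lparr>carrier := G\<rparr>) X \<phi>"
    and "infinite X"
    and "group W" and "carrier W \<noteq> {\<one>\<^bsub>W\<^esub>}"
  shows "\<not> finitely_presented (wreath_product W X \<phi> ((tree_aut A)\<lparr>carrier := G\<rparr>))"
proof
  let ?M = "(tree_aut A)\<lparr>carrier := G\<rparr>"
  assume fp: "finitely_presented (wreath_product W X \<phi> ?M)"
  interpret perm_wreath W ?M X \<phi>
    using assms(4,6) by (simp add: perm_wreath_def)
  obtain S where S: "finite S" "S \<subseteq> X"
    and pairs: "\<And>x y. \<lbrakk>x \<in> X; y \<in> X; x \<noteq> y\<rbrakk> \<Longrightarrow> \<exists>k\<in>carrier ?M. \<phi> k x \<in> S \<and> \<phi> k y \<in> S"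
    using finitely_presented_imp_cofinite_on_pairs[OF fp assms(7)] by blast
  have "\<exists>k\<in>G. \<phi> k x \<in> S \<and> \<phi> k y \<in> S" if xy: "x \<in> X" "y \<in> X" for x y
  proof (cases "x = y")
    case True
    \<comment> \<open>The wreath product argument speaks of distinct points only; a diagonal pair is
      moved into \<open>S\<close> along with any second point of \<open>X\<close>.\<close>
    obtain z where "z \<in> X" "z \<noteq> x"
      using infinite_remove[OF \<open>infinite X\<close>, of x] by (metis Diff_iff finite.emptyI insertI1 ex_in_conv)
    then show ?thesis using pairs[of x z] xy True by auto
  next
    case False
    then show ?thesis using pairs[OF xy] by auto
  qed
  then interpret branch_action A G X \<phi> S
    using assms(1-4) S by (intro branch_action.intro branch_action_axioms.intro) auto
  show False using finite_action_set \<open>infinite X\<close> by blast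
qed

end
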